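(* Let $\mathbb{K}$ be an algebraically closed field and let $q\in\mathbb{K}$ be a primitive $l$-th root of unity with $l\ge3$. Then the PI degree of the quantum spatial ageing algebra $\mathcal{A}$ equals $l^2$ if $l$ is odd and $\frac{l^2}{2}$ if $l$ is even.
   Context: The quantum spatial ageing algebra $\mathcal{A}$ is the $\mathbb{K}$-algebra generated by $E,K,K^{-1},X,Y$ ($K^{-1}$ the inverse of $K$) with relations $$EK=q^{-2}KE,\quad XK=q^{-1}KX,\quad YK=qKY,\quad EX=qXE,\quad EY=X+q^{-1}YE,\quad XY=qYX.$$ It is a prime (indeed a domain) polynomial identity algebra when $q$ is a root of unity, and PI degree has its usual meaning for prime PI algebras. *)

theory Defs
  imports "HOL-Library.Poly_Mapping" "HOL-Algebra.Algebraic_Closure_Type"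
begin

section \<open>Free algebras\<close>

text \<open>The free monoid, written additively because \<^typ>\<open>'a \<Rightarrow>\<^sub>0 'b\<close> is
  the monoid algebra when \<^typ>\<open>'a\<close> is a (not necessarily commutative) additive monoid.\<close>

datatype 'g word = Word "'g list"

instantiation word :: (type) monoid_add
begin

definition zero_word :: "'g word" where
  "zero_word = Word []"

fun plus_word :: "'g word \<Rightarrow> 'g word \<Rightarrow> 'g word" where
  "plus_word (Word u) (Word v) = Word (u @ v)"

instance
proof
  fix a b c :: "'g word"
  show "a + b + c = a + (b + c)" by (cases a; cases b; cases c) simp
  show "0 + a = a" by (cases a) (simp add: zero_word_def)
  show "a + 0 = a" by (cases a) (simp add: zero_word_def)
qed

end

type_synonym ('g, 'k) free_alg = "'g word \<Rightarrow>\<^sub>0 'k"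

definition var :: "'g \<Rightarrow> ('g, 'k::comm_ring_1) free_alg" where
  "var g = Poly_Mapping.single (Word [g]) 1"

definition const :: "'k::comm_ring_1 \<Rightarrow> ('g, 'k) free_alg" where
  "const c = Poly_Mapping.single 0 c"

text \<open>The algebra with the given relators (elements set to zero). The ideal
  \<^const>\<open>genideal\<close> is two-sided, and it is a subspace because the scalars are
  elements of the free algebra.\<close>

definition presented_algebra ::
    "('g, 'k::comm_ring_1) free_alg set \<Rightarrow> ('g, 'k) free_alg set ring" where
  "presented_algebra S =
     (ring_of_type_algebra :: ('g, 'k) free_alg ring) Quot
       (genideal (ring_of_type_algebra :: ('g, 'k) free_alg ring) S)"


section \<open>The quantum spatial ageing algebra\<close>

datatype ageing_gen = gE | gK | gKinv | gX | gY

definition ageing_relators :: "'k::field \<Rightarrow> (ageing_gen, 'k) free_alg set" where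
  "ageing_relators q =
     (let e = var gE; k = var gK; k' = var gKinv; x = var gX; y = var gY in
      { k * k' - 1,
        k' * k - 1,
        e * k - const (inverse (q ^ 2)) * k * e,
        x * k - const (inverse q) * k * x,
        y * k - const q * k * y,
        e * x - const q * x * e,
        e * y - (x + const (inverse q) * y * e),
        x * y - const q * y * x })"

definition ageing_algebra :: "'k::field \<Rightarrow> (ageing_gen, 'k) free_alg set ring" where
  "ageing_algebra q = presented_algebra (ageing_relators q)"


section \<open>PI degree\<close>

definition ring_center :: "('a, 'b) ring_scheme \<Rightarrow> 'a set" where
  "ring_center R = {z \<in> carrier R. \<forall>r \<in> carrier R. z \<otimes>\<^bsub>R\<^esub> r = r \<otimes>\<^bsub>R\<^esub> z}"

definition prime_ring :: "('a, 'b) ring_scheme \<Rightarrow> bool" where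
  "prime_ring R \<longleftrightarrow> ring R \<and> \<one>\<^bsub>R\<^esub> \<noteq> \<zero>\<^bsub>R\<^esub> \<and>
     (\<forall>a \<in> carrier R. \<forall>b \<in> carrier R.
        (\<forall>r \<in> carrier R. a \<otimes>\<^bsub>R\<^esub> r \<otimes>\<^bsub>R\<^esub> b = \<zero>\<^bsub>R\<^esub>) \<longrightarrow> a = \<zero>\<^bsub>R\<^esub> \<or> b = \<zero>\<^bsub>R\<^esub>)"

text \<open>Inverting the nonzero central elements of a prime ring; the pair \<open>(a, s)\<close> stands for
  \<open>a s\<inverse>\<close>. In a prime ring these elements are not zero divisors, so
  cross-multiplication already is an equivalence relation.\<close>

definition central_fractions :: "('a, 'b) ring_scheme \<Rightarrow> ('a \<times> 'a) set" where
  "central_fractions R = carrier R \<times> (ring_center R - {\<zero>\<^bsub>R\<^esub>})"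

definition fraction_rel :: "('a, 'b) ring_scheme \<Rightarrow> (('a \<times> 'a) \<times> ('a \<times> 'a)) set" where
  "fraction_rel R = {((a, s), (b, t)).
     (a, s) \<in> central_fractions R \<and> (b, t) \<in> central_fractions R \<and>
     a \<otimes>\<^bsub>R\<^esub> t = b \<otimes>\<^bsub>R\<^esub> s}"

definition central_localization :: "('a, 'b) ring_scheme \<Rightarrow> ('a \<times> 'a) set ring" where
  "central_localization R =
     \<lparr> carrier = central_fractions R // fraction_rel R,
       monoid.mult = (\<lambda>P Q. \<Union>(a, s) \<in> P. \<Union>(b, t) \<in> Q.
                 fraction_rel R `` {(a \<otimes>\<^bsub>R\<^esub> b, s \<otimes>\<^bsub>R\<^esub> t)}),
       one = fraction_rel R `` {(\<one>\<^bsub>R\<^esub>, \<one>\<^bsub>R\<^esub>)},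
       zero = fraction_rel R `` {(\<zero>\<^bsub>R\<^esub>, \<one>\<^bsub>R\<^esub>)},
       add = (\<lambda>P Q. \<Union>(a, s) \<in> P. \<Union>(b, t) \<in> Q.
                 fraction_rel R `` {(a \<otimes>\<^bsub>R\<^esub> t \<oplus>\<^bsub>R\<^esub> b \<otimes>\<^bsub>R\<^esub> s, s \<otimes>\<^bsub>R\<^esub> t)}) \<rparr>"

text \<open>By Posner's theorem, inverting the nonzero central elements of a prime PI ring \<open>R\<close>
  gives a ring \<open>Q\<close> of finite dimension \<open>n\<^sup>2\<close> over its centre, which is a field; \<open>n\<close> is the
  PI degree of \<open>R\<close>. Conversely, a prime ring whose \<open>Q\<close> is finite-dimensional over its centre
  is PI, so the polynomial identity needs no separate clause.\<close>

definition has_PI_degree :: "('a, 'b) ring_scheme \<Rightarrow> nat \<Rightarrow> bool" where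
  "has_PI_degree R n \<longleftrightarrow> prime_ring R \<and>
     (let Q = central_localization R
      in ring.dimension Q (n ^ 2) (ring_center Q) (carrier Q))"


section \<open>Primitive roots of unity\<close>

definition primitive_root_of_unity :: "nat \<Rightarrow> 'k::field \<Rightarrow> bool" where
  "primitive_root_of_unity l q \<longleftrightarrow> l > 0 \<and> q ^ l = 1 \<and> (\<forall>m. 0 < m \<and> m < l \<longrightarrow> q ^ m \<noteq> 1)"

end

theory Submission
  imports Defs "HOL-Algebra.Embedded_Algebras" "HOL-Library.Product_Lexorder" "HOL-Library.Product_Plus"
begin

text \<open>
  Put \<open>\<phi> = Y E - \<gamma> X\<close> with \<open>\<gamma> = 1 / (q - q\<inverse>)\<close>, which makes sense because \<open>q\<^sup>2 \<noteq> 1\<close> for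
  \<open>l \<ge> 3\<close>. Then \<open>K, Y, \<phi>, X\<close> commute with each other up to powers of \<open>q\<close>, and
  \<open>E = Y\<inverse> (\<phi> + \<gamma> X)\<close>. So after inverting \<open>Y\<close>, \<open>\<phi>\<close> and \<open>X\<close> the ageing algebra becomes a quantum
  torus: the algebra with basis \<open>e\<^sub>v\<close>, \<open>v \<in> \<int>\<^sup>4\<close>, and product \<open>e\<^sub>u e\<^sub>v = q\<^bsup>\<beta>(u,v)\<^esup> e\<^sub>u\<^sub>+\<^sub>v\<close>. The PI degree
  can be read off from the skew form \<open>\<beta>(u,v) - \<beta>(v,u)\<close> modulo \<open>l\<close>.

  The algebra really embeds into the torus. The defining relations let one rewrite every
  element as a combination of the ordered monomials \<open>K\<^sup>a Y\<^sup>b X\<^sup>c E\<^sup>d\<close> (\<open>all_spanned\<close>). Order the exponents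
  \<open>(a,b,c,d)\<close> of \<open>K\<^sup>a Y\<^sup>b \<phi>\<^sup>c X\<^sup>d\<close> lexicographically; then the image of \<open>E\<close> has leading term \<open>Y\<inverse>\<phi>\<close>,
  the leading exponents of the images of the ordered monomials are pairwise distinct
  (\<open>leading_monomial\<close>), and therefore the images are linearly independent (\<open>torus_map_eq_zero_iff\<close>).
  Leading exponents add under multiplication, so the torus and with it the ageing algebra have
  no zero divisors.

  The image contains all \<open>K\<^sup>a Y\<^sup>b \<phi>\<^sup>c X\<^sup>d\<close> with \<open>b, c, d \<ge> 0\<close>. An element that commutes with
  these is supported on the radical \<open>\<Lambda>\<close> of the skew form, so the centre consists of the elements
  supported on \<open>\<Lambda>\<close> (\<open>center_A_iff\<close>). Solving the congruences, \<open>(a,b,c,d) \<in> \<Lambda>\<close> means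
  \<open>m | a\<close>, \<open>m | c\<close>, \<open>b \<equiv> a\<close> and \<open>d \<equiv> a + c\<close> modulo \<open>l\<close>, where \<open>m\<close> is the order of \<open>q\<^sup>2\<close>, that is
  \<open>l\<close> for odd \<open>l\<close> and \<open>l/2\<close> for even \<open>l\<close>. Hence \<open>\<Lambda>\<close> has index \<open>(l m)\<^sup>2\<close> in \<open>\<int>\<^sup>4\<close>.

  Monomials with exponents in a set of representatives of \<open>\<int>\<^sup>4 / \<Lambda>\<close> are linearly independent over the
  centre, because their multiples have disjoint supports (\<open>independent_over_radical\<close>), and they
  generate the algebra up to a central factor (\<open>central_span\<close>). So they form a basis of the central
  localization over its centre (\<open>dimension_central_localization\<close>), which therefore has
  dimension \<open>(l m)\<^sup>2\<close>, and the PI degree is \<open>l m\<close>.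
\<close>

section \<open>Inverting the central elements of a prime ring\<close>

lemma (in ring) center_carrier: "z \<in> ring_center R \<Longrightarrow> z \<in> carrier R"
  by (simp add: ring_center_def)

lemma (in ring) center_commute: "z \<in> ring_center R \<Longrightarrow> r \<in> carrier R \<Longrightarrow> r \<otimes> z = z \<otimes> r"
  by (simp add: ring_center_def)

lemma (in ring) centerI:
  assumes "z \<in> carrier R" "\<And>r. r \<in> carrier R \<Longrightarrow> z \<otimes> r = r \<otimes> z"
  shows "z \<in> ring_center R"
  using assms by (simp add: ring_center_def)

lemma (in ring) center_left_commute:
  assumes z: "z \<in> ring_center R" and a: "a \<in> carrier R" and b: "b \<in> carrier R"
  shows "a \<otimes> (z \<otimes> b) = z \<otimes> (a \<otimes> b)"
proof -
  have "a \<otimes> z \<otimes> b = z \<otimes> a \<otimes> b"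
    by (simp only: center_commute[OF z a])
  then show ?thesis
    using center_carrier[OF z] a b by (simp add: m_assoc)
qed

lemma (in ring) subcring_center: "subcring (ring_center R) R"
proof (rule subcring.intro)
  show "subring (ring_center R) R"
  proof (rule subringI)
    show "ring_center R \<subseteq> carrier R"
      using center_carrier by blast
    show "\<one> \<in> ring_center R"
      by (simp add: ring_center_def)
  next
    fix z assume z: "z \<in> ring_center R"
    note zc = center_carrier[OF z]
    show "\<ominus> z \<in> ring_center R"
    proof (rule centerI)
      fix r assume r: "r \<in> carrier R"
      show "\<ominus> z \<otimes> r = r \<otimes> \<ominus> z"
        unfolding l_minus[OF zc r] r_minus[OF r zc] by (simp only: center_commute[OF z r])
    qed (use zc in simp)
  next
    fix y z assume y: "y \<in> ring_center R" and z: "z \<in> ring_center R"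
    note yc = center_carrier[OF y] and zc = center_carrier[OF z]
    show "y \<otimes> z \<in> ring_center R"
    proof (rule centerI)
      fix r assume r: "r \<in> carrier R"
      have "y \<otimes> z \<otimes> r = y \<otimes> (r \<otimes> z)"
        unfolding m_assoc[OF yc zc r] by (simp only: center_commute[OF z r])
      also have "\<dots> = r \<otimes> (y \<otimes> z)"
        by (rule center_left_commute[OF y r zc, symmetric])
      finally show "y \<otimes> z \<otimes> r = r \<otimes> (y \<otimes> z)" .
    qed (use yc zc in simp)
    show "y \<oplus> z \<in> ring_center R"
    proof (rule centerI)
      fix r assume r: "r \<in> carrier R"
      show "(y \<oplus> z) \<otimes> r = r \<otimes> (y \<oplus> z)"
        unfolding l_distr[OF yc zc r] r_distr[OF yc zc r]
        by (simp only: center_commute[OF z r] center_commute[OF y r])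
    qed (use yc zc in simp)
  qed
  show "subcring_axioms (ring_center R) R"
  proof (rule subcring_axioms.intro)
    fix y z assume "y \<in> ring_center R" "z \<in> ring_center R"
    then show "y \<otimes> z = z \<otimes> y"
      using center_commute center_carrier by metis
  qed
qed

locale central_inversion = ring R for R (structure) +
  assumes prime: "prime_ring R"
begin

abbreviation Z where "Z \<equiv> ring_center R"

abbreviation Q where "Q \<equiv> central_localization R"

abbreviation frac where "frac a s \<equiv> fraction_rel R `` {(a, s)}"

lemma center_one: "\<one> \<in> Z"
  by (simp add: ring_center_def)

lemma center_mult: "y \<in> Z \<Longrightarrow> z \<in> Z \<Longrightarrow> y \<otimes> z \<in> Z"
  using subringE(6)[OF subcring.axioms(1)[OF subcring_center]] .

lemma one_not_zero: "\<one> \<noteq> \<zero>"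
  using prime by (simp add: prime_ring_def)

text \<open>If \<open>a s = 0\<close> with \<open>s\<close> central then \<open>a r s = a s r = 0\<close> for all \<open>r\<close>, so primeness
  applies.\<close>

lemma center_regular:
  assumes "s \<in> Z - {\<zero>}" "a \<in> carrier R" "a \<otimes> s = \<zero>"
  shows "a = \<zero>"
proof -
  have s: "s \<in> Z" "s \<in> carrier R" "s \<noteq> \<zero>"
    using assms(1) center_carrier by auto
  have "a \<otimes> r \<otimes> s = \<zero>" if "r \<in> carrier R" for r
  proof -
    have "a \<otimes> r \<otimes> s = a \<otimes> s \<otimes> r"
      using that s assms(2) center_commute[OF s(1) that] by (simp add: m_assoc)
    then show ?thesis
      using that assms(3) by simp
  qed
  moreover have "(\<forall>r \<in> carrier R. a \<otimes> r \<otimes> s = \<zero>) \<longrightarrow> a = \<zero> \<or> s = \<zero>"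
    using prime s(2) assms(2) by (simp add: prime_ring_def)
  ultimately show ?thesis
    using s(3) by simp
qed

lemma center_cancel:
  assumes "s \<in> Z - {\<zero>}" "a \<in> carrier R" "b \<in> carrier R" "a \<otimes> s = b \<otimes> s"
  shows "a = b"
proof -
  have s: "s \<in> carrier R"
    using assms(1) center_carrier by auto
  have "(a \<ominus> b) \<otimes> s = \<zero>"
    using assms(2-4) s by (simp add: minus_eq l_distr l_minus r_neg)
  then have "a \<ominus> b = \<zero>"
    using center_regular[OF assms(1)] assms(2,3) by simp
  then show ?thesis
    using assms(2,3) by (simp add: r_right_minus_eq)
qed

lemma denominator_one: "\<one> \<in> Z - {\<zero>}"
  using center_one one_not_zero by simp

lemma denominator_mult:
  assumes "s \<in> Z - {\<zero>}" "t \<in> Z - {\<zero>}"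
  shows "s \<otimes> t \<in> Z - {\<zero>}"
  using assms center_mult center_regular[OF assms(2)] center_carrier by blast

lemma fraction_rel_iff:
  "((a, s), (b, t)) \<in> fraction_rel R \<longleftrightarrow>
     a \<in> carrier R \<and> s \<in> Z - {\<zero>} \<and> b \<in> carrier R \<and> t \<in> Z - {\<zero>} \<and> a \<otimes> t = b \<otimes> s"
  by (auto simp: fraction_rel_def central_fractions_def)

lemma swap_last:
  assumes "a \<in> carrier R" "s \<in> Z" "t \<in> Z"
  shows "a \<otimes> s \<otimes> t = a \<otimes> t \<otimes> s"
  using assms(1) center_carrier[OF assms(2)] center_carrier[OF assms(3)]
    center_commute[OF assms(2) center_carrier[OF assms(3)]]
  by (simp add: m_assoc)

lemma equiv_fraction_rel: "equiv (central_fractions R) (fraction_rel R)"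
proof (rule equivI)
  show "fraction_rel R \<subseteq> central_fractions R \<times> central_fractions R"
    by (auto simp: fraction_rel_def)
  show "refl_on (central_fractions R) (fraction_rel R)"
    by (auto simp: refl_on_def fraction_rel_def central_fractions_def)
  show "sym (fraction_rel R)"
    by (auto simp: sym_def fraction_rel_def)
  show "trans (fraction_rel R)"
  proof (rule transI, clarify)
    fix a s b t c u
    assume "((a, s), b, t) \<in> fraction_rel R" "((b, t), c, u) \<in> fraction_rel R"
    then have ab: "a \<otimes> t = b \<otimes> s" and bc: "b \<otimes> u = c \<otimes> t"
      and a: "a \<in> carrier R" and b: "b \<in> carrier R" and c: "c \<in> carrier R"
      and s: "s \<in> Z - {\<zero>}" and t: "t \<in> Z - {\<zero>}" and u: "u \<in> Z - {\<zero>}"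
      by (auto simp: fraction_rel_iff)
    have stu: "s \<in> carrier R" "t \<in> carrier R" "u \<in> carrier R"
      using s t u center_carrier by auto
    have "a \<otimes> u \<otimes> t = b \<otimes> s \<otimes> u"
      using ab a t u swap_last[of a u t] by simp
    also have "\<dots> = c \<otimes> t \<otimes> s"
      using bc b s u swap_last[of b s u] by simp
    also have "\<dots> = c \<otimes> s \<otimes> t"
      using c s t swap_last[of c t s] by simp
    finally have "a \<otimes> u = c \<otimes> s"
      using center_cancel[OF t] a c stu by simp
    then show "((a, s), c, u) \<in> fraction_rel R"
      using a c s u by (simp add: fraction_rel_iff)
  qed
qed

lemma frac_eq_iff:
  assumes "a \<in> carrier R" "s \<in> Z - {\<zero>}" "b \<in> carrier R" "t \<in> Z - {\<zero>}"
  shows "frac a s = frac b t \<longleftrightarrow> a \<otimes> t = b \<otimes> s"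
proof -
  have "frac a s = frac b t \<longleftrightarrow> ((a, s), (b, t)) \<in> fraction_rel R"
    using assms by (intro eq_equiv_class_iff[OF equiv_fraction_rel])
      (auto simp: central_fractions_def)
  then show ?thesis
    using assms by (simp add: fraction_rel_iff)
qed

lemma frac_carrier: "a \<in> carrier R \<Longrightarrow> s \<in> Z - {\<zero>} \<Longrightarrow> frac a s \<in> carrier Q"
  by (auto simp: central_localization_def central_fractions_def intro!: quotientI)

lemma carrier_cases:
  assumes "x \<in> carrier Q"
  obtains a s where "a \<in> carrier R" "s \<in> Z - {\<zero>}" "x = frac a s"
  using assms by (auto simp: central_localization_def central_fractions_def elim!: quotientE)

lemma frac_expand:
  assumes "a \<in> carrier R" "s \<in> Z - {\<zero>}" "t \<in> Z - {\<zero>}"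
  shows "frac (a \<otimes> t) (s \<otimes> t) = frac a s"
proof -
  have "a \<otimes> t \<otimes> s = a \<otimes> (s \<otimes> t)"
    using swap_last[of a t s] assms center_carrier by (simp add: m_assoc[symmetric])
  then show ?thesis
    using assms center_carrier denominator_mult by (subst frac_eq_iff) auto
qed

text \<open>Any two fractions have a common denominator; the ring axioms for fractions become trivial
  once they are stated for numerators over the same denominator.\<close>

lemma common_denominator:
  assumes "x \<in> carrier Q" "y \<in> carrier Q"
  obtains a b s where "a \<in> carrier R" "b \<in> carrier R" "s \<in> Z - {\<zero>}"
    "x = frac a s" "y = frac b s"
proof -
  obtain a s where a: "a \<in> carrier R" "s \<in> Z - {\<zero>}" "x = frac a s"
    using assms(1) carrier_cases by blast
  obtain b t where b: "b \<in> carrier R" "t \<in> Z - {\<zero>}" "y = frac b t"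
    using assms(2) carrier_cases by blast
  have "t \<otimes> s = s \<otimes> t"
    using a(2) b(2) center_commute center_carrier by auto
  then have "y = frac (b \<otimes> s) (s \<otimes> t)"
    using b a(2) frac_expand[OF b(1,2) a(2)] by simp
  moreover have "x = frac (a \<otimes> t) (s \<otimes> t)"
    using a b(2) frac_expand by simp
  ultimately show ?thesis
    using that[of "a \<otimes> t" "b \<otimes> s" "s \<otimes> t"] a b center_carrier denominator_mult by simp
qed

lemma common_denominator3:
  assumes "x \<in> carrier Q" "y \<in> carrier Q" "z \<in> carrier Q"
  obtains a b c s where "a \<in> carrier R" "b \<in> carrier R" "c \<in> carrier R" "s \<in> Z - {\<zero>}"
    "x = frac a s" "y = frac b s" "z = frac c s"
proof -
  obtain a b s where ab: "a \<in> carrier R" "b \<in> carrier R" "s \<in> Z - {\<zero>}"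
    "x = frac a s" "y = frac b s"
    using common_denominator[OF assms(1,2)] by blast
  obtain c t where c: "c \<in> carrier R" "t \<in> Z - {\<zero>}" "z = frac c t"
    using assms(3) carrier_cases by blast
  have "t \<otimes> s = s \<otimes> t"
    using ab(3) c(2) center_commute center_carrier by auto
  then have "z = frac (c \<otimes> s) (s \<otimes> t)"
    using c ab(3) frac_expand[OF c(1,2) ab(3)] by simp
  moreover have "x = frac (a \<otimes> t) (s \<otimes> t)" "y = frac (b \<otimes> t) (s \<otimes> t)"
    using ab c(2) frac_expand by simp_all
  ultimately show ?thesis
    using that[of "a \<otimes> t" "b \<otimes> t" "c \<otimes> s" "s \<otimes> t"] ab c center_carrier denominator_mult
    by simp
qed

text \<open>The operations of the localization are unions over all representatives of a class. They
  collapse to a single value as soon as that value does not depend on the representative.\<close>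

lemma UN_class_const:
  assumes "(a, s) \<in> central_fractions R"
    and "\<And>a' s'. ((a, s), (a', s')) \<in> fraction_rel R \<Longrightarrow> F a' s' = C"
  shows "(\<Union>(a', s') \<in> frac a s. F a' s') = C"
proof -
  have "((a, s), (a, s)) \<in> fraction_rel R"
    using assms(1) by (auto simp: fraction_rel_def)
  then show ?thesis
    using assms(2) by blast
qed

lemma mult_frac:
  assumes a: "a \<in> carrier R" and s: "s \<in> Z - {\<zero>}" and b: "b \<in> carrier R" and t: "t \<in> Z - {\<zero>}"
  shows "frac a s \<otimes>\<^bsub>Q\<^esub> frac b t = frac (a \<otimes> b) (s \<otimes> t)"
proof -
  have "frac (a' \<otimes> b') (s' \<otimes> t') = frac (a \<otimes> b) (s \<otimes> t)"
    if A: "((a, s), (a', s')) \<in> fraction_rel R" and B: "((b, t), (b', t')) \<in> fraction_rel R"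
    for a' s' b' t'
  proof -
    have h: "a' \<in> carrier R" "s' \<in> Z - {\<zero>}" "b' \<in> carrier R" "t' \<in> Z - {\<zero>}"
      "a \<otimes> s' = a' \<otimes> s" "b \<otimes> t' = b' \<otimes> t"
      using A B by (auto simp: fraction_rel_iff)
    have c: "s \<in> carrier R" "t \<in> carrier R" "s' \<in> carrier R" "t' \<in> carrier R"
      using s t h center_carrier by auto
    have "a \<otimes> b \<otimes> (s' \<otimes> t') = a \<otimes> s' \<otimes> (b \<otimes> t')"
      using a b c center_left_commute[of s' b t'] h(2,4) by (simp add: m_assoc)
    also have "\<dots> = a' \<otimes> s \<otimes> (b' \<otimes> t)"
      by (simp add: h)
    also have "\<dots> = a' \<otimes> b' \<otimes> (s \<otimes> t)"
      using h(1,3) c center_left_commute[of s b' t] s by (simp add: m_assoc)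
    finally show ?thesis
      using a b s t h c denominator_mult by (subst frac_eq_iff) auto
  qed
  then have "(\<Union>(a', s') \<in> frac a s. \<Union>(b', t') \<in> frac b t. frac (a' \<otimes> b') (s' \<otimes> t')) =
    frac (a \<otimes> b) (s \<otimes> t)"
    using a b s t by (intro UN_class_const) (simp_all add: central_fractions_def)
  then show ?thesis
    by (simp add: central_localization_def)
qed

lemma add_frac:
  assumes a: "a \<in> carrier R" and b: "b \<in> carrier R" and s: "s \<in> Z - {\<zero>}"
  shows "frac a s \<oplus>\<^bsub>Q\<^esub> frac b s = frac (a \<oplus> b) s"
proof -
  have "frac (a' \<otimes> t' \<oplus> b' \<otimes> s') (s' \<otimes> t') = frac (a \<oplus> b) s"
    if A: "((a, s), (a', s')) \<in> fraction_rel R" and B: "((b, s), (b', t')) \<in> fraction_rel R"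
    for a' s' b' t'
  proof -
    have h: "a' \<in> carrier R" "s' \<in> Z - {\<zero>}" "b' \<in> carrier R" "t' \<in> Z - {\<zero>}"
      "a \<otimes> s' = a' \<otimes> s" "b \<otimes> t' = b' \<otimes> s"
      using A B by (auto simp: fraction_rel_iff)
    have c: "s \<in> carrier R" "s' \<in> carrier R" "t' \<in> carrier R"
      using s h center_carrier by auto
    have "a' \<otimes> t' \<otimes> s = a \<otimes> s' \<otimes> t'"
      using h(1,2,4,5) s swap_last[of a' t' s] by simp
    moreover have "b' \<otimes> s' \<otimes> s = b \<otimes> t' \<otimes> s'"
      using h(3,2,4,6) s swap_last[of b' s' s] by simp
    moreover have "b \<otimes> t' \<otimes> s' = b \<otimes> (s' \<otimes> t')" "a \<otimes> s' \<otimes> t' = a \<otimes> (s' \<otimes> t')"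
      using a b c h(2,4) center_commute[of s' t'] by (simp_all add: m_assoc)
    ultimately have "(a' \<otimes> t' \<oplus> b' \<otimes> s') \<otimes> s = (a \<oplus> b) \<otimes> (s' \<otimes> t')"
      using a b c h by (simp add: l_distr)
    then show ?thesis
      using a b s h c denominator_mult by (subst frac_eq_iff) auto
  qed
  then have "(\<Union>(a', s') \<in> frac a s. \<Union>(b', t') \<in> frac b s.
    frac (a' \<otimes> t' \<oplus> b' \<otimes> s') (s' \<otimes> t')) = frac (a \<oplus> b) s"
    using a b s by (intro UN_class_const) (simp_all add: central_fractions_def)
  then show ?thesis
    by (simp add: central_localization_def)
qed

lemma zero_Q: "\<zero>\<^bsub>Q\<^esub> = frac \<zero> \<one>" and one_Q: "\<one>\<^bsub>Q\<^esub> = frac \<one> \<one>"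
  by (simp_all add: central_localization_def)

lemma zero_frac: "s \<in> Z - {\<zero>} \<Longrightarrow> frac \<zero> s = \<zero>\<^bsub>Q\<^esub>"
  using denominator_one center_carrier by (subst zero_Q, subst frac_eq_iff) auto

lemma one_frac: "s \<in> Z - {\<zero>} \<Longrightarrow> frac s s = \<one>\<^bsub>Q\<^esub>"
  using denominator_one center_carrier by (subst one_Q, subst frac_eq_iff) auto

lemma frac_eq_zero_iff:
  assumes "a \<in> carrier R" "s \<in> Z - {\<zero>}"
  shows "frac a s = \<zero>\<^bsub>Q\<^esub> \<longleftrightarrow> a = \<zero>"
  using assms denominator_one center_carrier by (subst zero_Q, subst frac_eq_iff) auto

lemma ring_Q: "ring Q"
proof (rule ringI)
  show "abelian_group Q"
  proof (rule abelian_groupI)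
    fix x y z assume x: "x \<in> carrier Q" and y: "y \<in> carrier Q" and z: "z \<in> carrier Q"
    obtain a b c s where h: "a \<in> carrier R" "b \<in> carrier R" "c \<in> carrier R" "s \<in> Z - {\<zero>}"
      "x = frac a s" "y = frac b s" "z = frac c s"
      using common_denominator3[OF x y z] by blast
    show "x \<oplus>\<^bsub>Q\<^esub> y \<in> carrier Q" "x \<oplus>\<^bsub>Q\<^esub> y \<oplus>\<^bsub>Q\<^esub> z = x \<oplus>\<^bsub>Q\<^esub> (y \<oplus>\<^bsub>Q\<^esub> z)"
      using h by (simp_all add: add_frac frac_carrier a_assoc)
    show "x \<oplus>\<^bsub>Q\<^esub> y = y \<oplus>\<^bsub>Q\<^esub> x"
      using h by (simp add: add_frac a_comm)
  next
    show "\<zero>\<^bsub>Q\<^esub> \<in> carrier Q"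
      using frac_carrier denominator_one by (simp add: zero_Q)
  next
    fix x assume "x \<in> carrier Q"
    then obtain a s where h: "a \<in> carrier R" "s \<in> Z - {\<zero>}" "x = frac a s"
      using carrier_cases by blast
    show "\<zero>\<^bsub>Q\<^esub> \<oplus>\<^bsub>Q\<^esub> x = x"
      using h add_frac[of \<zero> a s] by (simp add: zero_frac)
    show "\<exists>y\<in>carrier Q. y \<oplus>\<^bsub>Q\<^esub> x = \<zero>\<^bsub>Q\<^esub>"
      using h add_frac[of "\<ominus> a" a s] by (intro bexI[of _ "frac (\<ominus> a) s"])
        (simp_all add: zero_frac l_neg frac_carrier)
  qed
  show "Group.monoid Q"
  proof (rule monoidI)
    fix x y assume "x \<in> carrier Q" "y \<in> carrier Q"
    then show "x \<otimes>\<^bsub>Q\<^esub> y \<in> carrier Q"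
      by (elim carrier_cases) (auto simp: mult_frac intro!: frac_carrier denominator_mult)
  next
    show "\<one>\<^bsub>Q\<^esub> \<in> carrier Q"
      using frac_carrier denominator_one by (simp add: one_Q)
  next
    fix x y z assume "x \<in> carrier Q" "y \<in> carrier Q" "z \<in> carrier Q"
    then obtain a b c s t u where h: "a \<in> carrier R" "s \<in> Z - {\<zero>}" "x = frac a s"
      "b \<in> carrier R" "t \<in> Z - {\<zero>}" "y = frac b t" "c \<in> carrier R" "u \<in> Z - {\<zero>}" "z = frac c u"
      by (elim carrier_cases)
    have "s \<in> carrier R" "t \<in> carrier R" "u \<in> carrier R"
      using h center_carrier by auto
    then show "x \<otimes>\<^bsub>Q\<^esub> y \<otimes>\<^bsub>Q\<^esub> z = x \<otimes>\<^bsub>Q\<^esub> (y \<otimes>\<^bsub>Q\<^esub> z)"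
      unfolding h(3,6,9) using h(1,2,4,5,7,8) denominator_mult[OF h(2,5)] denominator_mult[OF h(5,8)]
      by (simp only: mult_frac m_closed m_assoc)
  next
    fix x assume "x \<in> carrier Q"
    then obtain a s where h: "a \<in> carrier R" "s \<in> Z - {\<zero>}" "x = frac a s"
      using carrier_cases by blast
    have "s \<in> carrier R"
      using h center_carrier by auto
    then show "\<one>\<^bsub>Q\<^esub> \<otimes>\<^bsub>Q\<^esub> x = x" "x \<otimes>\<^bsub>Q\<^esub> \<one>\<^bsub>Q\<^esub> = x"
      unfolding h(3) one_Q using h(1,2) denominator_one by (simp_all only: mult_frac one_closed l_one r_one)
  qed
next
  fix x y z assume x: "x \<in> carrier Q" and y: "y \<in> carrier Q" and z: "z \<in> carrier Q"
  obtain a b s where h: "a \<in> carrier R" "b \<in> carrier R" "s \<in> Z - {\<zero>}" "x = frac a s" "y = frac b s"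
    using common_denominator[OF x y] by blast
  obtain c t where k: "c \<in> carrier R" "t \<in> Z - {\<zero>}" "z = frac c t"
    using carrier_cases z by blast
  have m: "s \<otimes> t \<in> Z - {\<zero>}" "t \<otimes> s \<in> Z - {\<zero>}"
    using denominator_mult h(3) k(2) by simp_all
  show "(x \<oplus>\<^bsub>Q\<^esub> y) \<otimes>\<^bsub>Q\<^esub> z = x \<otimes>\<^bsub>Q\<^esub> z \<oplus>\<^bsub>Q\<^esub> y \<otimes>\<^bsub>Q\<^esub> z"
    and "z \<otimes>\<^bsub>Q\<^esub> (x \<oplus>\<^bsub>Q\<^esub> y) = z \<otimes>\<^bsub>Q\<^esub> x \<oplus>\<^bsub>Q\<^esub> z \<otimes>\<^bsub>Q\<^esub> y"
    unfolding h(4,5) k(3) using h(1-3) k(1,2) m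
    by (simp_all only: mult_frac add_frac m_closed a_closed l_distr r_distr)
qed

sublocale Q: ring Q
  by (rule ring_Q)

text \<open>If \<open>a s\<inverse>\<close> commutes with all \<open>r 1\<inverse>\<close> then the regular factor \<open>s\<close> can be cancelled from
  \<open>a r s = r a s\<close>, so the numerator is central too.\<close>

lemma center_Q: "ring_center Q = {frac z s | z s. z \<in> Z \<and> s \<in> Z - {\<zero>}}"
proof (intro subset_antisym subsetI)
  fix x assume "x \<in> ring_center Q"
  then have xQ: "x \<in> carrier Q" and comm: "\<And>y. y \<in> carrier Q \<Longrightarrow> x \<otimes>\<^bsub>Q\<^esub> y = y \<otimes>\<^bsub>Q\<^esub> x"
    unfolding ring_center_def by blast+
  obtain a s where h: "a \<in> carrier R" "s \<in> Z - {\<zero>}" "x = frac a s"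
    using carrier_cases xQ by blast
  have s: "s \<in> carrier R"
    using h center_carrier by auto
  have "a \<otimes> r = r \<otimes> a" if r: "r \<in> carrier R" for r
  proof -
    have "frac (a \<otimes> r) (s \<otimes> \<one>) = frac (r \<otimes> a) (\<one> \<otimes> s)"
      using comm[OF frac_carrier[OF r denominator_one]]
      unfolding h(3) mult_frac[OF h(1,2) r denominator_one] mult_frac[OF r denominator_one h(1,2)] .
    then have "a \<otimes> r \<otimes> s = r \<otimes> a \<otimes> s"
      using frac_eq_iff[OF _ h(2) _ h(2)] h(1) r s by simp
    then show ?thesis
      by (rule center_cancel[OF h(2), rotated 2]) (use h(1) r in simp_all)
  qed
  then have "a \<in> Z"
    unfolding ring_center_def using h(1) by blast
  then show "x \<in> {frac z s | z s. z \<in> Z \<and> s \<in> Z - {\<zero>}}"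
    using h(2,3) by blast
next
  fix x assume "x \<in> {frac z s | z s. z \<in> Z \<and> s \<in> Z - {\<zero>}}"
  then obtain z s where h: "z \<in> Z" "s \<in> Z - {\<zero>}" "x = frac z s"
    by blast
  have z: "z \<in> carrier R"
    using h center_carrier by simp
  have "x \<otimes>\<^bsub>Q\<^esub> y = y \<otimes>\<^bsub>Q\<^esub> x" if y: "y \<in> carrier Q" for y
  proof -
    obtain b t where k: "b \<in> carrier R" "t \<in> Z - {\<zero>}" "y = frac b t"
      using carrier_cases[OF y] .
    have "s \<in> Z" "t \<in> carrier R"
      using h(2) k(2) center_carrier by simp_all
    then have ts: "t \<otimes> s = s \<otimes> t"
      by (rule center_commute)
    show ?thesis
      unfolding h(3) k(3) mult_frac[OF z h(2) k(1,2)] mult_frac[OF k(1,2) z h(2)]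
      by (simp only: ts center_commute[OF h(1) k(1)])
  qed
  then show "x \<in> ring_center Q"
    unfolding ring_center_def[of Q] mem_Collect_eq h(3)
    using frac_carrier[OF z h(2)] by (intro conjI ballI)
qed

text \<open>The inverse of \<open>z s\<inverse>\<close> with \<open>z\<close> central and nonzero is \<open>s z\<inverse>\<close>.\<close>

lemma subfield_center_Q: "subfield (ring_center Q) Q"
proof (rule Q.subfieldI)
  show "subcring (ring_center Q) Q"
    by (rule Q.subcring_center)
  show "Units (Q\<lparr>carrier := ring_center Q\<rparr>) = ring_center Q - {\<zero>\<^bsub>Q\<^esub>}"
  proof (intro subset_antisym subsetI)
    fix x assume "x \<in> Units (Q\<lparr>carrier := ring_center Q\<rparr>)"
    then obtain y where x: "x \<in> ring_center Q" and y: "y \<in> ring_center Q" "y \<otimes>\<^bsub>Q\<^esub> x = \<one>\<^bsub>Q\<^esub>"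
      by (auto simp: Units_def)
    have "\<one>\<^bsub>Q\<^esub> \<noteq> \<zero>\<^bsub>Q\<^esub>"
      using one_not_zero frac_eq_zero_iff[OF _ denominator_one] by (simp add: one_Q)
    then have "x \<noteq> \<zero>\<^bsub>Q\<^esub>"
      using y Q.center_carrier by auto
    then show "x \<in> ring_center Q - {\<zero>\<^bsub>Q\<^esub>}"
      using x by simp
  next
    fix x assume "x \<in> ring_center Q - {\<zero>\<^bsub>Q\<^esub>}"
    then obtain z s where h: "z \<in> Z" "s \<in> Z - {\<zero>}" "x = frac z s" and x: "x \<in> ring_center Q"
      "x \<noteq> \<zero>\<^bsub>Q\<^esub>"
      by (auto simp: center_Q)
    have c: "z \<in> carrier R" "s \<in> carrier R"
      using h center_carrier by auto
    have z: "z \<in> Z - {\<zero>}"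
      using x(2) h c frac_eq_zero_iff by simp
    have "z \<otimes> s = s \<otimes> z"
      using center_commute[OF h(1) c(2)] by simp
    then have "frac s z \<otimes>\<^bsub>Q\<^esub> x = \<one>\<^bsub>Q\<^esub>" "x \<otimes>\<^bsub>Q\<^esub> frac s z = \<one>\<^bsub>Q\<^esub>"
      unfolding h(3) using one_frac[OF denominator_mult[OF h(2) z]] z h(2) c
      by (simp_all only: mult_frac)
    moreover have "frac s z \<in> ring_center Q"
      using h(2) z by (auto simp: center_Q)
    ultimately show "x \<in> Units (Q\<lparr>carrier := ring_center Q\<rparr>)"
      using x(1) by (auto simp: Units_def)
  qed
qed

lemma combine_frac:
  assumes "set ks \<subseteq> carrier R" "set us \<subseteq> carrier R" "s \<in> Z - {\<zero>}"
  shows "Q.combine (map (\<lambda>k. frac k s) ks) (map (\<lambda>u. frac u \<one>) us) = frac (combine ks us) s"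
  using assms
proof (induction ks us rule: combine.induct)
  case (1 k ks u us)
  have "s \<in> carrier R"
    using 1 center_carrier by auto
  then show ?case
    using 1 denominator_one by (simp add: mult_frac add_frac)
qed (simp_all add: zero_frac)

lemma common_denominator_list:
  assumes "set xs \<subseteq> ring_center Q"
  obtains ks s where "set ks \<subseteq> Z" "s \<in> Z - {\<zero>}" "xs = map (\<lambda>k. frac k s) ks"
  using assms
proof (induction xs arbitrary: thesis)
  case Nil
  show ?case
    by (rule Nil(1)[of "[]" \<one>]) (use denominator_one in auto)
next
  case (Cons x xs)
  obtain ks s where IH: "set ks \<subseteq> Z" "s \<in> Z - {\<zero>}" "xs = map (\<lambda>k. frac k s) ks"
    using Cons by auto
  have "x \<in> ring_center Q"
    using Cons by simp
  then obtain z t where x: "z \<in> Z" "t \<in> Z - {\<zero>}" "x = frac z t"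
    by (auto simp: center_Q)
  have *: "frac (k \<otimes> t) (s \<otimes> t) = frac k s" if "k \<in> Z" for k
    using frac_expand that IH x center_carrier by simp
  have "t \<otimes> s = s \<otimes> t"
    using IH x center_commute center_carrier by auto
  then have "x = frac (z \<otimes> s) (s \<otimes> t)"
    using frac_expand[of z t s] x IH center_carrier by simp
  moreover have "xs = map (\<lambda>k. frac k (s \<otimes> t)) (map (\<lambda>k. k \<otimes> t) ks)"
    using IH * by auto
  ultimately show ?case
    using IH(1,2) x(1,2)
    by (intro Cons(2)[of "z \<otimes> s # map (\<lambda>k. k \<otimes> t) ks" "s \<otimes> t"])
       (use denominator_mult in \<open>auto intro!: center_mult\<close>)
qed

text \<open>A list that is linearly independent over the centre and generates \<open>R\<close> up to central
  denominators becomes a basis of the localization over its centre.\<close>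

theorem dimension_central_localization:
  assumes us: "set us \<subseteq> carrier R"
    and indep: "\<And>ks. set ks \<subseteq> Z \<Longrightarrow> length ks = length us \<Longrightarrow> combine ks us = \<zero> \<Longrightarrow> set ks \<subseteq> {\<zero>}"
    and span: "\<And>r. r \<in> carrier R \<Longrightarrow>
      \<exists>z ks. z \<in> Z - {\<zero>} \<and> set ks \<subseteq> Z \<and> length ks = length us \<and> z \<otimes> r = combine ks us"
  shows "Q.dimension (length us) (ring_center Q) (carrier Q)"
proof -
  let ?us = "map (\<lambda>u. frac u \<one>) us"
  have us_carrier: "set ?us \<subseteq> carrier Q"
    using us frac_carrier denominator_one by auto
  have Z_carrier: "Z \<subseteq> carrier R"
    using center_carrier by blast
  have "Q.independent (ring_center Q) ?us"
  proof (rule Q.trivial_combine_imp_independent[OF subfield_center_Q us_carrier])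
    fix xs assume xs: "set xs \<subseteq> ring_center Q" and comb: "Q.combine xs ?us = \<zero>\<^bsub>Q\<^esub>"
    have xs_carrier: "set xs \<subseteq> carrier Q"
      using xs by (auto simp: ring_center_def)
    obtain xs' where xs': "set (take (length ?us) xs) \<subseteq> set xs'"
      "set xs' \<subseteq> set (take (length ?us) xs) \<union> {\<zero>\<^bsub>Q\<^esub>}" "length xs' = length ?us"
      "Q.combine xs' ?us = \<zero>\<^bsub>Q\<^esub>"
      using Q.combine_normalize[OF xs_carrier us_carrier comb] by blast
    have "\<zero>\<^bsub>Q\<^esub> \<in> ring_center Q"
      by (simp add: ring_center_def)
    then have "set xs' \<subseteq> ring_center Q"
      using xs'(2) xs set_take_subset[of "length ?us" xs] by blast
    then obtain ks s where ks: "set ks \<subseteq> Z" "s \<in> Z - {\<zero>}" "xs' = map (\<lambda>k. frac k s) ks"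
      using common_denominator_list by blast
    have kc: "set ks \<subseteq> carrier R"
      using ks(1) Z_carrier by blast
    have "frac (combine ks us) s = \<zero>\<^bsub>Q\<^esub>"
      using xs'(4) combine_frac[OF kc us ks(2)] ks(3) by simp
    then have "combine ks us = \<zero>"
      using frac_eq_zero_iff ks(2) kc us by simp
    moreover have "length ks = length us"
      using ks(3) xs'(3) by simp
    ultimately have "set ks \<subseteq> {\<zero>}"
      using indep ks(1) by simp
    then have "set xs' \<subseteq> {\<zero>\<^bsub>Q\<^esub>}"
      using ks(2,3) zero_frac by auto
    then show "set (take (length ?us) xs) \<subseteq> {\<zero>\<^bsub>Q\<^esub>}"
      using xs'(1) by blast
  qed
  moreover have "Q.Span (ring_center Q) ?us = carrier Q"
  proof
    show "Q.Span (ring_center Q) ?us \<subseteq> carrier Q"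
      using Q.Span_in_carrier[OF _ us_carrier] by (auto simp: ring_center_def)
    show "carrier Q \<subseteq> Q.Span (ring_center Q) ?us"
    proof
      fix x assume "x \<in> carrier Q"
      then obtain r s where r: "r \<in> carrier R" "s \<in> Z - {\<zero>}" "x = frac r s"
        using carrier_cases by blast
      obtain z ks where z: "z \<in> Z - {\<zero>}" "set ks \<subseteq> Z" "length ks = length us"
        "z \<otimes> r = combine ks us"
        using span[OF r(1)] by blast
      have zs: "s \<otimes> z \<in> Z - {\<zero>}"
        using denominator_mult r z by simp
      have "x = frac (r \<otimes> z) (s \<otimes> z)"
        using r z frac_expand by simp
      also have "r \<otimes> z = combine ks us"
        using z center_commute[OF _ r(1), of z] by simp
      also have "frac (combine ks us) (s \<otimes> z) = Q.combine (map (\<lambda>k. frac k (s \<otimes> z)) ks) ?us"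
        using z us zs Z_carrier by (intro combine_frac[symmetric]) auto
      finally have "x = Q.combine (map (\<lambda>k. frac k (s \<otimes> z)) ks) ?us" .
      moreover have "set (map (\<lambda>k. frac k (s \<otimes> z)) ks) \<subseteq> ring_center Q"
        using z(2) zs by (auto simp: center_Q)
      ultimately show "x \<in> Q.Span (ring_center Q) ?us"
        using Q.Span_mem_iff_length_version[OF subfield_center_Q us_carrier] z(3)
        by (metis length_map)
    qed
  qed
  ultimately show ?thesis
    using Q.dimension_independent by (metis length_map)
qed

end

section \<open>Additive maps on finitely supported functions\<close>

lemma poly_mapping_additive_induct [case_names single add]:
  fixes f :: "'a \<Rightarrow>\<^sub>0 'b::comm_monoid_add"
  assumes single: "\<And>a b. P (Poly_Mapping.single a b)"
    and add: "\<And>f g. P f \<Longrightarrow> P g \<Longrightarrow> P (f + g)"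
  shows "P f"
proof (induction f rule: Poly_Mapping.update_induct)
  case const
  show ?case
    using single[of undefined 0] by simp
next
  case (update f a b)
  have "Poly_Mapping.update a b f = f + Poly_Mapping.single a b"
    using update(1) by (intro poly_mapping_eqI)
      (auto simp: lookup_update lookup_add lookup_single in_keys_iff when_def)
  then show ?case
    using add[OF update(3) single] by simp
qed

text \<open>The additive map that takes the value \<open>F k a\<close> on the function with the single value \<open>a\<close> at
  \<open>k\<close>, provided each \<open>F k\<close> is additive. The product of a twisted group algebra and the homomorphisms
  from a free algebra are both of this form.\<close>

definition extend :: "('a \<Rightarrow> 'b::zero \<Rightarrow> 'c::comm_monoid_add) \<Rightarrow> ('a \<Rightarrow>\<^sub>0 'b) \<Rightarrow> 'c" where
  "extend F p = (\<Sum>k\<in>Poly_Mapping.keys p. F k (Poly_Mapping.lookup p k))"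

lemma extend_single: "F a 0 = 0 \<Longrightarrow> extend F (Poly_Mapping.single a b) = F a b"
  by (simp add: extend_def)

lemma extend_add:
  assumes "\<And>k. F k 0 = 0" "\<And>k a b. F k (a + b) = F k a + F k b"
  shows "extend F (p + q) = extend F p + extend F q"
  unfolding extend_def by (rule setsum_keys_plus_distrib) (simp_all add: assms)

lemma extend_fun_add: "extend (\<lambda>k a. F k a + G k a) p = extend F p + extend G p"
  by (simp add: extend_def sum.distrib)

lemma extend_zero: "extend F 0 = 0"
  by (simp add: extend_def)

section \<open>Twisted group algebras\<close>

text \<open>A bicharacter \<open>\<sigma>\<close> on an abelian group is a 2-cocycle, so twisting the product of the group
  algebra by it preserves associativity. A group order makes leading exponents available.\<close>

locale bicharacter =
  fixes \<sigma> :: "'g::linordered_ab_group_add \<Rightarrow> 'g \<Rightarrow> 'k::field"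
  assumes add_left: "\<sigma> (u + v) w = \<sigma> u w * \<sigma> v w"
    and add_right: "\<sigma> u (v + w) = \<sigma> u v * \<sigma> u w"
    and nonzero: "\<sigma> u v \<noteq> 0"
begin

lemma zero_left [simp]: "\<sigma> 0 v = 1"
  using add_left[of 0 0 v] nonzero[of 0 v] by simp

lemma zero_right [simp]: "\<sigma> u 0 = 1"
  using add_right[of u 0 0] nonzero[of u 0] by simp

lemma diff_left: "\<sigma> (u - v) w = \<sigma> u w / \<sigma> v w"
  using add_left[of "u - v" v w] nonzero[of v w] by (simp add: field_simps)

lemma diff_right: "\<sigma> u (v - w) = \<sigma> u v / \<sigma> u w"
  using add_right[of u "v - w" w] nonzero[of u w] by (simp add: field_simps)

definition tmult :: "('g \<Rightarrow>\<^sub>0 'k) \<Rightarrow> ('g \<Rightarrow>\<^sub>0 'k) \<Rightarrow> ('g \<Rightarrow>\<^sub>0 'k)" (infixl \<open>\<star>\<close> 70) where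
  "f \<star> g = extend (\<lambda>u a. extend (\<lambda>v b. Poly_Mapping.single (u + v) (\<sigma> u v * a * b)) g) f"

lemma single_tmult_single:
  "Poly_Mapping.single u a \<star> Poly_Mapping.single v b = Poly_Mapping.single (u + v) (\<sigma> u v * a * b)"
  by (simp add: tmult_def extend_single)

lemma inner_zero: "extend (\<lambda>v b. Poly_Mapping.single (u + v) (\<sigma> u v * 0 * b)) g = 0"
  by (simp add: extend_def)

lemma tmult_add_left: "(f + g) \<star> h = f \<star> h + g \<star> h"
  unfolding tmult_def
proof (rule extend_add)
  fix u a b
  show "extend (\<lambda>v b. Poly_Mapping.single (u + v) (\<sigma> u v * 0 * b)) h = 0"
    by (rule inner_zero)
  show "extend (\<lambda>v c. Poly_Mapping.single (u + v) (\<sigma> u v * (a + b) * c)) h =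
    extend (\<lambda>v c. Poly_Mapping.single (u + v) (\<sigma> u v * a * c)) h +
    extend (\<lambda>v c. Poly_Mapping.single (u + v) (\<sigma> u v * b * c)) h"
    by (simp add: extend_fun_add[symmetric] ring_distribs single_add)
qed

lemma tmult_add_right: "f \<star> (g + h) = f \<star> g + f \<star> h"
proof -
  have "extend (\<lambda>v b. Poly_Mapping.single (u + v) (\<sigma> u v * a * b)) (g + h) =
    extend (\<lambda>v b. Poly_Mapping.single (u + v) (\<sigma> u v * a * b)) g +
    extend (\<lambda>v b. Poly_Mapping.single (u + v) (\<sigma> u v * a * b)) h" for u a
    by (rule extend_add) (simp_all add: ring_distribs single_add)
  then show ?thesis
    by (simp add: tmult_def extend_fun_add)
qed

lemma tmult_zero_left [simp]: "0 \<star> f = 0"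
  by (simp add: tmult_def extend_zero)

lemma tmult_zero_right [simp]: "f \<star> 0 = 0"
  by (simp add: tmult_def extend_def)

lemma tmult_assoc: "f \<star> g \<star> h = f \<star> (g \<star> h)"
proof (induction f rule: poly_mapping_additive_induct)
  case f: (single u a)
  show ?case
  proof (induction g rule: poly_mapping_additive_induct)
    case g: (single v b)
    show ?case
    proof (induction h rule: poly_mapping_additive_induct)
      case (single w c)
      show ?case
        by (simp add: single_tmult_single add_left add_right add.assoc mult_ac)
    qed (simp add: tmult_add_right)
  qed (simp add: tmult_add_left tmult_add_right)
qed (simp add: tmult_add_left)

abbreviation scalar :: "'k \<Rightarrow> ('g \<Rightarrow>\<^sub>0 'k)" where
  "scalar c \<equiv> Poly_Mapping.single 0 c"

lemma scalar_commute: "f \<star> scalar c = scalar c \<star> f"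
  by (induction f rule: poly_mapping_additive_induct)
    (simp_all add: single_tmult_single tmult_add_left tmult_add_right mult_ac)

lemma scalar_one_left [simp]: "scalar 1 \<star> f = f"
  by (induction f rule: poly_mapping_additive_induct)
    (simp_all add: single_tmult_single tmult_add_left tmult_add_right del: single_one)

lemma scalar_one_right [simp]: "f \<star> scalar 1 = f"
  by (simp add: scalar_commute del: single_one)

lemma one_tmult [simp]: "1 \<star> f = f" and tmult_one [simp]: "f \<star> 1 = f"
  using scalar_one_left[of f] scalar_one_right[of f] by simp_all

lemma lookup_tmult_single:
  "Poly_Mapping.lookup (f \<star> Poly_Mapping.single w c) x = \<sigma> (x - w) w * Poly_Mapping.lookup f (x - w) * c"
  by (induction f rule: poly_mapping_additive_induct)
    (auto simp: single_tmult_single tmult_add_left lookup_add lookup_single when_def ring_distribs)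

lemma lookup_single_tmult:
  "Poly_Mapping.lookup (Poly_Mapping.single w c \<star> f) x = \<sigma> w (x - w) * c * Poly_Mapping.lookup f (x - w)"
  by (induction f rule: poly_mapping_additive_induct)
    (auto simp: single_tmult_single tmult_add_right lookup_add lookup_single when_def ring_distribs)

text \<open>Multiplying by \<open>e\<^sub>w\<close> from either side moves \<open>v\<close> to \<open>v + w\<close> and only changes the coefficient,
  so commutation is decided exponent by exponent.\<close>

lemma commute_monomial_iff:
  "f \<star> Poly_Mapping.single w 1 = Poly_Mapping.single w 1 \<star> f \<longleftrightarrow>
     (\<forall>v\<in>Poly_Mapping.keys f. \<sigma> v w = \<sigma> w v)"
proof
  assume eq: "f \<star> Poly_Mapping.single w 1 = Poly_Mapping.single w 1 \<star> f"
  show "\<forall>v\<in>Poly_Mapping.keys f. \<sigma> v w = \<sigma> w v"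
  proof
    fix v assume "v \<in> Poly_Mapping.keys f"
    then show "\<sigma> v w = \<sigma> w v"
      using arg_cong[OF eq, of "\<lambda>h. Poly_Mapping.lookup h (v + w)"]
      by (simp add: lookup_tmult_single lookup_single_tmult in_keys_iff)
  qed
next
  assume *: "\<forall>v\<in>Poly_Mapping.keys f. \<sigma> v w = \<sigma> w v"
  show "f \<star> Poly_Mapping.single w 1 = Poly_Mapping.single w 1 \<star> f"
  proof (rule poly_mapping_eqI)
    fix x
    show "Poly_Mapping.lookup (f \<star> Poly_Mapping.single w 1) x =
      Poly_Mapping.lookup (Poly_Mapping.single w 1 \<star> f) x"
      using * by (cases "x - w \<in> Poly_Mapping.keys f")
        (auto simp: lookup_tmult_single lookup_single_tmult in_keys_iff)
  qed
qed

lemma commute_monomial_scaled: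
  assumes "\<forall>v\<in>Poly_Mapping.keys f. \<sigma> v w = \<sigma> w v"
  shows "f \<star> Poly_Mapping.single w c = Poly_Mapping.single w c \<star> f"
proof -
  have "Poly_Mapping.single w c = scalar c \<star> Poly_Mapping.single w 1"
    by (simp add: single_tmult_single)
  then show ?thesis
    using assms commute_monomial_iff[of f w] by (metis scalar_commute tmult_assoc)
qed

lemma central_if_radical:
  assumes "\<And>v w. v \<in> Poly_Mapping.keys f \<Longrightarrow> \<sigma> v w = \<sigma> w v"
  shows "f \<star> g = g \<star> f"
  by (induction g rule: poly_mapping_additive_induct)
    (use assms in \<open>simp_all add: commute_monomial_scaled tmult_add_left tmult_add_right\<close>)

subsection \<open>Leading exponents\<close>

definition leading :: "('g \<Rightarrow>\<^sub>0 'k) \<Rightarrow> 'g \<Rightarrow> bool" where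
  "leading f u \<longleftrightarrow> u \<in> Poly_Mapping.keys f \<and> (\<forall>v\<in>Poly_Mapping.keys f. v \<le> u)"

lemma leading_exists: "f \<noteq> 0 \<Longrightarrow> \<exists>u. leading f u"
  by (rule exI[of _ "Max (Poly_Mapping.keys f)"]) (simp add: leading_def)

lemma leading_nonzero: "leading f u \<Longrightarrow> f \<noteq> 0"
  by (auto simp: leading_def)

lemma leading_single: "a \<noteq> 0 \<Longrightarrow> leading (Poly_Mapping.single u a) u"
  by (simp add: leading_def)

lemma lookup_tmult:
  "Poly_Mapping.lookup (f \<star> g) x = (\<Sum>u\<in>Poly_Mapping.keys f. \<Sum>v\<in>Poly_Mapping.keys g.
     \<sigma> u v * Poly_Mapping.lookup f u * Poly_Mapping.lookup g v when u + v = x)"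
  by (simp add: tmult_def extend_def lookup_sum lookup_single)

text \<open>If \<open>u' \<le> u\<close> and \<open>v' \<le> v\<close> then \<open>u' + v' = u + v\<close> forces equality in both, so the two leading terms
  meet no other contribution to their product.\<close>

lemma leading_tmult:
  assumes f: "leading f u" and g: "leading g v"
  shows "leading (f \<star> g) (u + v)"
proof -
  have *: "u' = u \<and> v' = v" if "u' \<in> Poly_Mapping.keys f" "v' \<in> Poly_Mapping.keys g" "u + v \<le> u' + v'"
    for u' v'
  proof -
    have "u' \<le> u" "v' \<le> v"
      using f g that by (auto simp: leading_def)
    then show ?thesis
      using that(3) add_less_le_mono[of u' u v' v] add_le_less_mono[of u' u v' v]
      by (metis leD order_le_less)
  qed
  have "Poly_Mapping.lookup (f \<star> g) (u + v) =
    (\<Sum>u'\<in>Poly_Mapping.keys f. \<Sum>v'\<in>Poly_Mapping.keys g.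
      (if v' = v then (if u' = u then \<sigma> u v * Poly_Mapping.lookup f u * Poly_Mapping.lookup g v else 0) else 0))"
    unfolding lookup_tmult using * by (intro sum.cong refl) (auto simp: when_def)
  also have "\<dots> = \<sigma> u v * Poly_Mapping.lookup f u * Poly_Mapping.lookup g v"
    using f g by (simp add: leading_def)
  also have "\<dots> \<noteq> 0"
    using f g nonzero by (simp add: leading_def in_keys_iff)
  finally have "u + v \<in> Poly_Mapping.keys (f \<star> g)"
    by (simp add: in_keys_iff)
  moreover have "x \<le> u + v" if "x \<in> Poly_Mapping.keys (f \<star> g)" for x
  proof (rule ccontr)
    assume "\<not> x \<le> u + v"
    then have x: "u + v < x"
      by simp
    have "u' + v' \<noteq> x" if "u' \<in> Poly_Mapping.keys f" "v' \<in> Poly_Mapping.keys g" for u' v'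
    proof
      assume eq: "u' + v' = x"
      then have "u' = u \<and> v' = v"
        using x by (intro *[OF that]) simp
      then show False
        using x eq by simp
    qed
    then have "Poly_Mapping.lookup (f \<star> g) x = 0"
      unfolding lookup_tmult by (intro sum.neutral ballI) (simp add: when_def)
    then show False
      using that by (simp add: in_keys_iff)
  qed
  ultimately show ?thesis
    by (simp add: leading_def)
qed

lemma tmult_eq_zero_iff: "f \<star> g = 0 \<longleftrightarrow> f = 0 \<or> g = 0"
  using leading_exists leading_nonzero leading_tmult by (metis tmult_zero_left tmult_zero_right)

text \<open>In a nontrivial combination, look at the largest leading exponent that occurs: only one
  of the elements has it in its support.\<close>

lemma leading_independent:
  fixes p :: "'i \<Rightarrow>\<^sub>0 'k"
  assumes lead: "\<And>i. leading (m i) (t i)" and inj: "inj t"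
    and zero: "(\<Sum>i\<in>Poly_Mapping.keys p. scalar (Poly_Mapping.lookup p i) \<star> m i) = 0"
  shows "p = 0"
proof (rule ccontr)
  assume "p \<noteq> 0"
  then have ne: "t ` Poly_Mapping.keys p \<noteq> {}"
    by simp
  define M where "M = Max (t ` Poly_Mapping.keys p)"
  have "M \<in> t ` Poly_Mapping.keys p"
    unfolding M_def using ne by (intro Max_in) auto
  then obtain j where j: "j \<in> Poly_Mapping.keys p" "M = t j"
    by blast
  have small: "Poly_Mapping.lookup (m i) (t j) = 0" if i: "i \<in> Poly_Mapping.keys p" "i \<noteq> j" for i
  proof -
    have "t i \<le> t j"
      unfolding j(2)[symmetric] M_def using i by (intro Max_ge) auto
    moreover have "t i \<noteq> t j"
      using i inj by (auto dest: injD)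
    ultimately show ?thesis
      using lead[of i] by (force simp: leading_def in_keys_iff)
  qed
  have "0 = (\<Sum>i\<in>Poly_Mapping.keys p. Poly_Mapping.lookup p i * Poly_Mapping.lookup (m i) (t j))"
    using arg_cong[OF zero, of "\<lambda>h. Poly_Mapping.lookup h (t j)"]
    by (simp add: lookup_sum lookup_single_tmult)
  also have "\<dots> = (\<Sum>i\<in>Poly_Mapping.keys p.
    if i = j then Poly_Mapping.lookup p j * Poly_Mapping.lookup (m j) (t j) else 0)"
    using small by (intro sum.cong) auto
  also have "\<dots> \<noteq> 0"
    using j lead[of j] by (simp add: leading_def in_keys_iff)
  finally show False
    by simp
qed

subsection \<open>Homomorphisms from the free algebra\<close>

definition word_value :: "('x \<Rightarrow> ('g \<Rightarrow>\<^sub>0 'k)) \<Rightarrow> 'x word \<Rightarrow> ('g \<Rightarrow>\<^sub>0 'k)" where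
  "word_value \<eta> w = (case w of Word xs \<Rightarrow> foldr (\<lambda>x f. \<eta> x \<star> f) xs 1)"

text \<open>The universal property of the free algebra: the algebra homomorphism that extends an
  assignment \<open>\<eta>\<close> of the generators.\<close>

definition substitute :: "('x \<Rightarrow> ('g \<Rightarrow>\<^sub>0 'k)) \<Rightarrow> ('x, 'k) free_alg \<Rightarrow> ('g \<Rightarrow>\<^sub>0 'k)" where
  "substitute \<eta> = extend (\<lambda>w a. scalar a \<star> word_value \<eta> w)"

lemma word_value_add: "word_value \<eta> (v + w) = word_value \<eta> v \<star> word_value \<eta> w"
proof (cases v; cases w)
  fix xs ys assume "v = Word xs" "w = Word ys"
  moreover have "word_value \<eta> (Word (xs @ ys)) = word_value \<eta> (Word xs) \<star> word_value \<eta> (Word ys)"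
    by (induction xs) (simp_all add: word_value_def tmult_assoc)
  ultimately show ?thesis
    by simp
qed

lemma substitute_single:
  "substitute \<eta> (Poly_Mapping.single w a) = scalar a \<star> word_value \<eta> w"
  by (simp add: substitute_def extend_single)

lemma substitute_add: "substitute \<eta> (f + g) = substitute \<eta> f + substitute \<eta> g"
  unfolding substitute_def by (rule extend_add) (simp_all add: tmult_add_left single_add)

lemma substitute_zero [simp]: "substitute \<eta> 0 = 0"
  by (simp add: substitute_def extend_zero)

lemma substitute_minus: "substitute \<eta> (- f) = - substitute \<eta> f"
  using substitute_add[of \<eta> "- f" f] by (simp add: eq_neg_iff_add_eq_0)

lemma substitute_diff: "substitute \<eta> (f - g) = substitute \<eta> f - substitute \<eta> g"
  using substitute_add[of \<eta> f "- g"] by (simp add: substitute_minus)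

lemma substitute_mult: "substitute \<eta> (f * g) = substitute \<eta> f \<star> substitute \<eta> g"
proof (induction f rule: poly_mapping_additive_induct)
  case f: (single v a)
  show ?case
  proof (induction g rule: poly_mapping_additive_induct)
    case (single w b)
    have "scalar a \<star> word_value \<eta> v \<star> (scalar b \<star> word_value \<eta> w) =
      scalar a \<star> (word_value \<eta> v \<star> scalar b) \<star> word_value \<eta> w"
      by (simp only: tmult_assoc)
    also have "\<dots> = (scalar a \<star> scalar b) \<star> (word_value \<eta> v \<star> word_value \<eta> w)"
      by (simp only: scalar_commute[of "word_value \<eta> v" b] tmult_assoc)
    also have "\<dots> = substitute \<eta> (Poly_Mapping.single v a * Poly_Mapping.single w b)"
      by (simp add: mult_single substitute_single word_value_add single_tmult_single)
    finally show ?case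
      by (simp add: substitute_single)
  qed (simp add: ring_distribs substitute_add tmult_add_right)
qed (simp add: ring_distribs substitute_add tmult_add_left)

lemma substitute_const: "substitute \<eta> (const c) = scalar c"
  by (simp add: const_def substitute_single word_value_def zero_word_def)

lemma substitute_var: "substitute \<eta> (var x) = \<eta> x"
  by (simp add: var_def substitute_single word_value_def)

lemma substitute_one: "substitute \<eta> 1 = 1"
  using substitute_const[of \<eta> 1] by (simp add: const_def)

end

section \<open>Algebras presented by relators\<close>

lemma ring_ring_of_type_algebra: "ring (ring_of_type_algebra :: 'a::ring_1 ring)"
proof -
  have "\<exists>y. x + y = 0" for x :: 'a
    using add.right_inverse by blast
  then show ?thesis
    unfolding ring_of_type_algebra_def using add.right_inverse
    by unfold_locales (auto simp: algebra_simps Units_def)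
qed

abbreviation relation_ideal :: "('g, 'k::comm_ring_1) free_alg set \<Rightarrow> ('g, 'k) free_alg set" where
  "relation_ideal S \<equiv> genideal ring_of_type_algebra S"

abbreviation coset :: "('g, 'k::comm_ring_1) free_alg set \<Rightarrow> ('g, 'k) free_alg \<Rightarrow> ('g, 'k) free_alg set" where
  "coset S f \<equiv> a_r_coset ring_of_type_algebra (relation_ideal S) f"

lemma ideal_relation_ideal: "ideal (relation_ideal S) ring_of_type_algebra"
  by (rule ring.genideal_ideal[OF ring_ring_of_type_algebra]) (simp add: ring_of_type_algebra_def)

lemma type_algebra_minus: "a \<ominus>\<^bsub>ring_of_type_algebra\<^esub> b = (a - b :: 'a::ring_1)"
proof -
  interpret ring "ring_of_type_algebra :: 'a ring"
    by (rule ring_ring_of_type_algebra)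
  have "\<ominus>\<^bsub>ring_of_type_algebra\<^esub> b = - b"
    by (rule minus_equality) (simp_all add: ring_of_type_algebra_def)
  then show ?thesis
    by (simp add: a_minus_def) (simp add: ring_of_type_algebra_def)
qed

lemma relation_ideal_relator: "r \<in> S \<Longrightarrow> r \<in> relation_ideal S"
  using ring.genideal_self[OF ring_ring_of_type_algebra, of S] by (auto simp: ring_of_type_algebra_def)

lemma relation_ideal_zero: "0 \<in> relation_ideal S"
  using additive_subgroup.zero_closed[OF ideal.axioms(1)[OF ideal_relation_ideal]]
  by (simp add: ring_of_type_algebra_def)

lemma relation_ideal_add: "f \<in> relation_ideal S \<Longrightarrow> g \<in> relation_ideal S \<Longrightarrow> f + g \<in> relation_ideal S"
  using additive_subgroup.a_closed[OF ideal.axioms(1)[OF ideal_relation_ideal], of f S g]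
  by (simp add: ring_of_type_algebra_def)

lemma relation_ideal_mult_left: "f \<in> relation_ideal S \<Longrightarrow> h * f \<in> relation_ideal S"
  using ideal.I_l_closed[OF ideal_relation_ideal, of f S h]
  by (simp add: ring_of_type_algebra_def)

lemma relation_ideal_mult_right: "f \<in> relation_ideal S \<Longrightarrow> f * h \<in> relation_ideal S"
  using ideal.I_r_closed[OF ideal_relation_ideal, of f S h]
  by (simp add: ring_of_type_algebra_def)

lemma relation_ideal_minus: "f \<in> relation_ideal S \<Longrightarrow> - f \<in> relation_ideal S"
  using relation_ideal_mult_left[of f S "- 1"] by simp

lemma relation_ideal_minimal:
  assumes "ideal I ring_of_type_algebra" "S \<subseteq> I"
  shows "relation_ideal S \<subseteq> I"
  by (rule ring.genideal_minimal[OF ring_ring_of_type_algebra assms])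

lemma ring_presented_algebra: "ring (presented_algebra S)"
  unfolding presented_algebra_def by (rule ideal.quotient_is_ring[OF ideal_relation_ideal])

lemma carrier_presented_algebra: "carrier (presented_algebra S) = range (coset S)"
  by (auto simp: presented_algebra_def FactRing_def A_RCOSETS_def RCOSETS_def a_r_coset_def
    ring_of_type_algebra_def)

lemma coset_eq_iff: "coset S f = coset S g \<longleftrightarrow> f - g \<in> relation_ideal S"
  using ring.quotient_eq_iff_same_a_r_cos[OF ring_ring_of_type_algebra ideal_relation_ideal, of f g S]
  by (simp add: type_algebra_minus) (simp add: ring_of_type_algebra_def)

lemma mult_coset: "coset S f \<otimes>\<^bsub>presented_algebra S\<^esub> coset S g = coset S (f * g)"
  using ideal.rcoset_mult_add[OF ideal_relation_ideal, of f g S]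
  by (simp add: presented_algebra_def FactRing_def) (simp add: ring_of_type_algebra_def)

lemma add_coset: "coset S f \<oplus>\<^bsub>presented_algebra S\<^esub> coset S g = coset S (f + g)"
  using abelian_subgroup.a_rcos_sum[OF abelian_subgroupI3[OF ideal.axioms(1)[OF ideal_relation_ideal]
      ring.is_abelian_group[OF ring_ring_of_type_algebra]], of f g S]
  by (simp add: presented_algebra_def FactRing_def) (simp add: ring_of_type_algebra_def)

lemma one_presented_algebra: "\<one>\<^bsub>presented_algebra S\<^esub> = coset S 1"
  by (simp add: presented_algebra_def FactRing_def) (simp add: ring_of_type_algebra_def)

lemma zero_presented_algebra: "\<zero>\<^bsub>presented_algebra S\<^esub> = coset S 0"
proof -
  have "\<zero>\<^bsub>presented_algebra S\<^esub> = relation_ideal S"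
    by (simp add: presented_algebra_def FactRing_def)
  also have "\<dots> = coset S 0"
    by (auto simp: a_r_coset_def r_coset_def ring_of_type_algebra_def)
  finally show ?thesis .
qed

subsection \<open>Calculating modulo the relators\<close>

definition congruent_mod :: "('g, 'k::comm_ring_1) free_alg set \<Rightarrow> ('g, 'k) free_alg \<Rightarrow> ('g, 'k) free_alg \<Rightarrow> bool" where
  "congruent_mod S f g \<longleftrightarrow> f - g \<in> relation_ideal S"

lemma congruent_mod_refl: "congruent_mod S f f"
  by (simp add: congruent_mod_def relation_ideal_zero)

lemma congruent_mod_sym: "congruent_mod S f g \<Longrightarrow> congruent_mod S g f"
  using relation_ideal_minus[of "f - g" S] by (simp add: congruent_mod_def)

lemma congruent_mod_trans [trans]:
  "congruent_mod S f g \<Longrightarrow> congruent_mod S g h \<Longrightarrow> congruent_mod S f h"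
  using relation_ideal_add[of "f - g" S "g - h"] by (simp add: congruent_mod_def)

lemma congruent_mod_add:
  "congruent_mod S f g \<Longrightarrow> congruent_mod S f' g' \<Longrightarrow> congruent_mod S (f + f') (g + g')"
  using relation_ideal_add[of "f - g" S "f' - g'"] by (simp add: congruent_mod_def algebra_simps)

lemma congruent_mod_mult_left: "congruent_mod S f g \<Longrightarrow> congruent_mod S (h * f) (h * g)"
  using relation_ideal_mult_left[of "f - g" S h] by (simp add: congruent_mod_def algebra_simps)

lemma congruent_mod_mult_right: "congruent_mod S f g \<Longrightarrow> congruent_mod S (f * h) (g * h)"
  using relation_ideal_mult_right[of "f - g" S h] by (simp add: congruent_mod_def algebra_simps)

lemma congruent_mod_relator: "f - g \<in> S \<Longrightarrow> congruent_mod S f g"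
  by (simp add: congruent_mod_def relation_ideal_relator)

lemma const_add: "const (a + b) = const a + const b"
  by (simp add: const_def single_add)

lemma const_mult: "const (a * b) = const a * const b"
  by (simp add: const_def mult_single)

lemma const_one [simp]: "const 1 = 1"
  by (simp add: const_def)

lemma const_zero [simp]: "const 0 = 0"
  by (simp add: const_def)

lemma const_commute: "f * const c = const c * f"
  by (induction f rule: poly_mapping_additive_induct)
    (simp_all add: const_def mult_single ring_distribs mult.commute)

text \<open>Multiplication by a scalar, kept apart from the product of the free algebra: as an explicit
  factor, a constant could be moved past other constants for ever by the simplifier.\<close>

definition scale :: "'k::comm_ring_1 \<Rightarrow> ('g, 'k) free_alg \<Rightarrow> ('g, 'k) free_alg" where
  "scale c f = const c * f"

lemma scale_simps [simp]:
  "f * scale c g = scale c (f * g)"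
  "scale c f * g = scale c (f * g)"
  "scale c (scale d f) = scale (c * d) f"
  "scale c (f + g) = scale c f + scale c g"
  "scale 1 f = f"
  "scale 0 f = 0"
proof -
  have "f * const c * g = const c * f * g"
    by (simp only: const_commute)
  then show "f * scale c g = scale c (f * g)"
    by (simp add: scale_def mult.assoc)
qed (simp_all add: scale_def mult.assoc const_mult distrib_left)

lemma scale_add_left: "scale (c + d) f = scale c f + scale d f"
  by (simp add: scale_def const_add distrib_right)

lemma congruent_mod_scale: "congruent_mod S f g \<Longrightarrow> congruent_mod S (scale c f) (scale c g)"
  unfolding scale_def by (rule congruent_mod_mult_left)

lemma single_Word_Cons: "Poly_Mapping.single (Word (x # xs)) 1 = var x * Poly_Mapping.single (Word xs) 1"
  by (simp add: var_def mult_single)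

lemma single_eq_scale: "Poly_Mapping.single w a = scale a (Poly_Mapping.single w 1)"
  by (simp add: scale_def const_def mult_single)

section \<open>Ordered monomials span the ageing algebra\<close>

text \<open>For the spanning property only the existence of the scalar matters.\<close>

definition semicommute :: "('g, 'k::comm_ring_1) free_alg set \<Rightarrow> ('g, 'k) free_alg \<Rightarrow> ('g, 'k) free_alg \<Rightarrow> bool" where
  "semicommute S u v \<longleftrightarrow> (\<exists>c. congruent_mod S (u * v) (scale c (v * u)))"

lemma semicommute_one: "semicommute S u 1"
  unfolding semicommute_def by (rule exI[of _ 1]) (simp add: congruent_mod_refl)

lemma semicommute_mult:
  assumes "semicommute S u v" "semicommute S u w"
  shows "semicommute S u (v * w)"
proof -
  obtain c d where c: "congruent_mod S (u * v) (scale c (v * u))"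
    and d: "congruent_mod S (u * w) (scale d (w * u))"
    using assms by (auto simp: semicommute_def)
  have "congruent_mod S (u * (v * w)) (scale c (v * (u * w)))"
    using congruent_mod_mult_right[OF c, of w] by (simp add: mult.assoc)
  also have "congruent_mod S (scale c (v * (u * w))) (scale (c * d) (v * w * u))"
    using congruent_mod_scale[OF congruent_mod_mult_left[OF d, of v], of c]
    by (simp add: mult.assoc)
  finally show ?thesis
    unfolding semicommute_def by blast
qed

lemma semicommute_power: "semicommute S u v \<Longrightarrow> semicommute S u (v ^ n)"
  by (induction n) (simp_all add: semicommute_one semicommute_mult)

text \<open>Multiply \<open>u v = c v u\<close> by \<open>w = v\<inverse>\<close> on both sides to get \<open>w u = c u w\<close>.\<close>

lemma semicommute_inverse:
  fixes c :: "'k::field"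
  assumes uv: "congruent_mod S (u * v) (scale c (v * u))" and c: "c \<noteq> 0"
    and vw: "congruent_mod S (v * w) 1" and wv: "congruent_mod S (w * v) 1"
  shows "semicommute S u w"
proof -
  have "congruent_mod S (w * u) (w * u * (v * w))"
    using congruent_mod_sym[OF congruent_mod_mult_left[OF vw, of "w * u"]] by simp
  also have "congruent_mod S (w * u * (v * w)) (scale c ((w * v) * (u * w)))"
    using congruent_mod_mult_left[OF congruent_mod_mult_right[OF uv, of w], of w]
    by (simp add: mult.assoc)
  also have "congruent_mod S (scale c ((w * v) * (u * w))) (scale c (u * w))"
    using congruent_mod_scale[OF congruent_mod_mult_right[OF wv, of "u * w"], of c]
    by simp
  finally have "congruent_mod S (scale (inverse c) (w * u)) (u * w)"
    using congruent_mod_scale[of S "w * u" "scale c (u * w)" "inverse c"] c by simp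
  then show ?thesis
    unfolding semicommute_def by (blast intro: congruent_mod_sym)
qed

type_synonym exponents = "int \<times> nat \<times> nat \<times> nat"

locale ageing_parameter =
  fixes q :: "'k::field"
  assumes q_nonzero: "q \<noteq> 0"
begin

abbreviation relators where "relators \<equiv> ageing_relators q"

abbreviation cong_rel (infix \<open>\<doteq>\<close> 50) where "f \<doteq> g \<equiv> congruent_mod relators f g"

abbreviation vE :: "(ageing_gen, 'k) free_alg" where "vE \<equiv> var gE"
abbreviation vK :: "(ageing_gen, 'k) free_alg" where "vK \<equiv> var gK"
abbreviation vK' :: "(ageing_gen, 'k) free_alg" where "vK' \<equiv> var gKinv"
abbreviation vX :: "(ageing_gen, 'k) free_alg" where "vX \<equiv> var gX"
abbreviation vY :: "(ageing_gen, 'k) free_alg" where "vY \<equiv> var gY"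

lemma relations:
  "vK * vK' \<doteq> 1" "vK' * vK \<doteq> 1" "vE * vK \<doteq> scale (inverse (q ^ 2)) (vK * vE)"
  "vX * vK \<doteq> scale (inverse q) (vK * vX)" "vY * vK \<doteq> scale q (vK * vY)"
  "vE * vX \<doteq> scale q (vX * vE)" "vE * vY \<doteq> vX + scale (inverse q) (vY * vE)"
  "vX * vY \<doteq> scale q (vY * vX)"
  by (rule congruent_mod_relator; simp add: ageing_relators_def Let_def scale_def mult.assoc)+

definition K_power :: "int \<Rightarrow> (ageing_gen, 'k) free_alg" where
  "K_power a = (if a \<ge> 0 then vK ^ nat a else vK' ^ nat (- a))"

lemma K_times_K_power: "vK * K_power a \<doteq> K_power (a + 1)"
proof (cases "a \<ge> 0")
  case True
  then show ?thesis
    by (simp add: K_power_def nat_add_distrib congruent_mod_refl)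
next
  case False
  then have "nat (- a) = Suc (nat (- (a + 1)))"
    by simp
  moreover have "K_power (a + 1) = vK' ^ nat (- (a + 1))"
    using False by (simp add: K_power_def)
  ultimately show ?thesis
    using False congruent_mod_mult_right[OF relations(1), of "vK' ^ nat (- (a + 1))"]
    by (simp add: K_power_def mult.assoc)
qed

lemma K'_times_K_power: "vK' * K_power a \<doteq> K_power (a - 1)"
proof (cases "a \<ge> 1")
  case True
  then have "nat a = Suc (nat (a - 1))"
    by simp
  then show ?thesis
    using True congruent_mod_mult_right[OF relations(2), of "vK ^ nat (a - 1)"]
    by (simp add: K_power_def mult.assoc)
next
  case False
  then have "nat (1 - a) = Suc (nat (- a))"
    by simp
  moreover have "K_power a = vK' ^ nat (- a)"
    using False by (simp add: K_power_def)
  ultimately show ?thesis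
    using False by (simp add: K_power_def congruent_mod_refl)
qed

lemma semicommute_K_power:
  assumes "u * vK \<doteq> scale c (vK * u)" "c \<noteq> 0"
  shows "semicommute relators u (K_power a)"
proof -
  have "semicommute relators u vK"
    using assms(1) by (auto simp: semicommute_def)
  moreover have "semicommute relators u vK'"
    using semicommute_inverse[OF assms relations(1,2)] .
  ultimately show ?thesis
    by (simp add: K_power_def semicommute_power)
qed

lemma semicommute_gens:
  "semicommute relators vE (K_power a)" "semicommute relators vX (K_power a)"
  "semicommute relators vY (K_power a)" "semicommute relators vE (vX ^ n)" "semicommute relators vX (vY ^ n)"
proof -
  show "semicommute relators vE (K_power a)" "semicommute relators vX (K_power a)"
    "semicommute relators vY (K_power a)"
    using relations(3-5)[THEN semicommute_K_power] q_nonzero by simp_all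
  show "semicommute relators vE (vX ^ n)" "semicommute relators vX (vY ^ n)"
    using relations(6,8) by (auto intro!: semicommute_power simp: semicommute_def[of _ _ vX] semicommute_def[of _ _ vY])
qed

text \<open>The only relation that is not a commutation up to a scalar is the one between \<open>E\<close> and \<open>Y\<close>.
  Moving \<open>E\<close> past a power of \<open>Y\<close> leaves a correction term that contains no \<open>E\<close> and is already ordered.\<close>

lemma E_times_Y_power:
  "\<exists>c d. vE * vY ^ Suc n \<doteq> scale c (vY ^ Suc n * vE) + scale d (vY ^ n * vX)"
proof (induction n)
  case 0
  show ?case
    using relations(7) by (intro exI[of _ "inverse q"] exI[of _ 1]) (simp add: add.commute)
next
  case (Suc n)
  then obtain c d where cd: "vE * vY ^ Suc n \<doteq> scale c (vY ^ Suc n * vE) + scale d (vY ^ n * vX)"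
    by blast
  have "vE * vY ^ Suc (Suc n) = vE * vY ^ Suc n * vY"
    by (simp only: power_Suc2[of vY "Suc n"] mult.assoc)
  also have "\<dots> \<doteq> (scale c (vY ^ Suc n * vE) + scale d (vY ^ n * vX)) * vY"
    by (rule congruent_mod_mult_right[OF cd])
  also have "\<dots> = scale c (vY ^ Suc n * (vE * vY)) + scale d (vY ^ n * (vX * vY))"
    by (simp only: scale_simps distrib_right mult.assoc)
  also have "\<dots> \<doteq> scale c (vY ^ Suc n * (vX + scale (inverse q) (vY * vE))) +
    scale d (vY ^ n * scale q (vY * vX))"
    by (intro congruent_mod_add congruent_mod_scale congruent_mod_mult_left relations)
  also have "\<dots> = scale (c * inverse q) (vY ^ Suc (Suc n) * vE) + scale (c + d * q) (vY ^ Suc n * vX)"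
  proof -
    have "vY ^ Suc (Suc n) * vE = vY ^ Suc n * (vY * vE)" "vY ^ Suc n * vX = vY ^ n * (vY * vX)"
      by (simp_all only: power_Suc2 mult.assoc)
    then show ?thesis
      by (simp only: scale_simps distrib_left scale_add_left add.assoc add.commute add.left_commute)
  qed
  finally show ?case
    by blast
qed

definition monomial :: "exponents \<Rightarrow> (ageing_gen, 'k) free_alg" where
  "monomial = (\<lambda>(a, b, c, d). K_power a * (vY ^ b * (vX ^ c * vE ^ d)))"

definition combination :: "(exponents \<Rightarrow>\<^sub>0 'k) \<Rightarrow> (ageing_gen, 'k) free_alg" where
  "combination = extend (\<lambda>i a. scale a (monomial i))"

definition spanned :: "(ageing_gen, 'k) free_alg \<Rightarrow> bool" where
  "spanned f \<longleftrightarrow> (\<exists>p. f \<doteq> combination p)"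

lemma combination_single: "combination (Poly_Mapping.single i a) = scale a (monomial i)"
  by (simp add: combination_def extend_single)

lemma combination_add: "combination (p + p') = combination p + combination p'"
  unfolding combination_def by (rule extend_add) (simp_all add: scale_add_left)

lemma spanned_cong: "f \<doteq> g \<Longrightarrow> spanned g \<Longrightarrow> spanned f"
  unfolding spanned_def using congruent_mod_trans by blast

lemma spanned_add: "spanned f \<Longrightarrow> spanned g \<Longrightarrow> spanned (f + g)"
  unfolding spanned_def by (metis combination_add congruent_mod_add)

lemma spanned_monomial: "spanned (K_power a * (vY ^ b * (vX ^ c * vE ^ d)))"
  unfolding spanned_def
  by (rule exI[of _ "Poly_Mapping.single (a, b, c, d) 1"])
    (simp add: combination_single monomial_def congruent_mod_refl)

lemma spanned_scale:
  assumes "spanned f"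
  shows "spanned (scale c f)"
proof -
  have "spanned (scale c (combination p))" for p
  proof (induction p rule: poly_mapping_additive_induct)
    case (single i a)
    show ?case
      unfolding spanned_def
      by (rule exI[of _ "Poly_Mapping.single i (c * a)"])
        (simp add: combination_single congruent_mod_refl)
  qed (simp add: combination_add spanned_add)
  then show ?thesis
    using assms congruent_mod_scale spanned_cong unfolding spanned_def[of f] by blast
qed

lemma spanned_swap:
  assumes "semicommute relators u v" "spanned (p * (v * (u * w)))"
  shows "spanned (p * (u * (v * w)))"
proof -
  obtain c where c: "u * v \<doteq> scale c (v * u)"
    using assms(1) by (auto simp: semicommute_def)
  have "p * (u * (v * w)) \<doteq> scale c (p * (v * (u * w)))"
    using congruent_mod_mult_left[OF congruent_mod_mult_right[OF c, of w], of p]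
    by (simp add: mult.assoc)
  then show ?thesis
    using spanned_cong spanned_scale[OF assms(2)] by blast
qed

text \<open>Each generator is moved to its place from the left. The correction term from moving \<open>E\<close>
  past \<open>Y\<^sup>b\<close> is again an ordered monomial up to a scalar.\<close>

lemma spanned_gen_monomial: "spanned (var g * monomial i)"
proof -
  obtain a b c d where i: "i = (a, b, c, d)"
    by (cases i)
  let ?p = "K_power a" and ?y = "vY ^ b" and ?x = "vX ^ c" and ?e = "vE ^ d"
  have XY: "spanned (?p * (vX * (?y * (?x * ?e))))"
    by (rule spanned_swap[OF semicommute_gens(5)])
      (use spanned_monomial[of a b "Suc c" d] in \<open>simp add: mult.assoc\<close>)
  show ?thesis
  proof (cases g)
    case gK
    show ?thesis
      unfolding gK i monomial_def prod.case
      using congruent_mod_mult_right[OF K_times_K_power, of a "?y * (?x * ?e)"]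
        spanned_monomial[of "a + 1" b c d] spanned_cong by (simp add: mult.assoc)
  next
    case gKinv
    show ?thesis
      unfolding gKinv i monomial_def prod.case
      using congruent_mod_mult_right[OF K'_times_K_power, of a "?y * (?x * ?e)"]
        spanned_monomial[of "a - 1" b c d] spanned_cong by (simp add: mult.assoc)
  next
    case gY
    have "spanned (?p * (vY * (?y * (?x * ?e))))"
      using spanned_monomial[of a "Suc b" c d] by (simp add: mult.assoc)
    then show ?thesis
      unfolding gY i monomial_def prod.case
      using spanned_swap[OF semicommute_gens(3), of 1] by simp
  next
    case gX
    show ?thesis
      unfolding gX i monomial_def prod.case
      using spanned_swap[OF semicommute_gens(2), of 1] XY by simp
  next
    case gE
    have EX: "spanned (?p * (?y * (vE * (?x * ?e))))"
    proof -
      have "spanned (?p * ?y * (?x * (vE * ?e)))"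
        using spanned_monomial[of a b c "Suc d"] by (simp add: mult.assoc)
      then show ?thesis
        using spanned_swap[OF semicommute_gens(4), of "?p * ?y"] by (simp add: mult.assoc)
    qed
    have "spanned (?p * (vE * (?y * (?x * ?e))))"
    proof (cases b)
      case 0
      then show ?thesis
        using EX by simp
    next
      case (Suc n)
      obtain r s where rs: "vE * vY ^ Suc n \<doteq> scale r (vY ^ Suc n * vE) + scale s (vY ^ n * vX)"
        using E_times_Y_power by blast
      have "?p * (vE * (?y * (?x * ?e))) \<doteq>
        scale r (?p * (?y * (vE * (?x * ?e)))) + scale s (?p * (vY ^ n * (vX * (?x * ?e))))"
        using congruent_mod_mult_left[OF congruent_mod_mult_right[OF rs, of "?x * ?e"], of ?p]
        unfolding Suc by (simp only: distrib_left distrib_right mult.assoc scale_simps)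
      moreover have "spanned (?p * (vY ^ n * (vX * (?x * ?e))))"
        using spanned_monomial[of a n "Suc c" d] by (simp add: mult.assoc)
      ultimately show ?thesis
        using EX spanned_add spanned_scale spanned_cong by blast
    qed
    then show ?thesis
      unfolding gE i monomial_def prod.case
      using spanned_swap[OF semicommute_gens(1), of 1] by simp
  qed
qed

lemma spanned_gen_mult:
  assumes "spanned f"
  shows "spanned (var g * f)"
proof -
  have "spanned (var g * combination p)" for p
  proof (induction p rule: poly_mapping_additive_induct)
    case (single i a)
    show ?case
      using spanned_scale[OF spanned_gen_monomial]
      by (simp add: combination_single)
  qed (simp add: combination_add distrib_left spanned_add)
  then show ?thesis
    using assms congruent_mod_mult_left spanned_cong unfolding spanned_def[of f] by blast
qed

text \<open>The span of the ordered monomials contains \<open>1\<close> and is stable under left multiplication by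
  the generators, hence it contains every word.\<close>

theorem all_spanned: "spanned f"
proof (induction f rule: poly_mapping_additive_induct)
  case (single w a)
  obtain xs where w: "w = Word xs"
    by (cases w)
  have "spanned (Poly_Mapping.single (Word xs) 1)"
  proof (induction xs)
    case Nil
    have "spanned (1 :: (ageing_gen, 'k) free_alg)"
      using spanned_monomial[of 0 0 0 0] by (simp add: K_power_def)
    then show ?case
      by (simp add: zero_word_def[symmetric])
  next
    case (Cons x xs)
    then show ?case
      unfolding single_Word_Cons by (rule spanned_gen_mult)
  qed
  then show ?case
    unfolding w single_eq_scale[of _ a] by (rule spanned_scale)
qed (rule spanned_add)

end

section \<open>Exponents and powers of a primitive root of unity\<close>

type_synonym torus_exponent = "int \<times> int \<times> int \<times> int"

text \<open>With the lexicographic order, exponent vectors over \<open>\<int>\<close> form an ordered group, as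
  leading exponents in twisted group algebras require.\<close>

instance prod :: (linordered_ab_group_add, linordered_ab_group_add) linordered_ab_group_add
proof
  fix a b c :: "'a \<times> 'b"
  assume "a \<le> b"
  then show "c + a \<le> c + b"
    by (auto simp: less_eq_prod_def)
qed

locale ageing_at_root = ageing_parameter q for q :: "'k::field" +
  fixes l :: nat
  assumes l_ge_3: "l \<ge> 3" and root: "primitive_root_of_unity l q"
begin

lemma q_power_int_eq_1_iff: "q powi n = 1 \<longleftrightarrow> int l dvd n"
proof -
  have ql: "q powi int l = 1"
    using root by (simp add: primitive_root_of_unity_def)
  have "q powi n = q powi (int l * (n div int l) + n mod int l)"
    by simp
  also have "\<dots> = (q powi int l) powi (n div int l) * q powi (n mod int l)"
    by (subst power_int_add) (simp_all only: q_nonzero power_int_mult simp_thms)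
  also have "\<dots> = q powi (n mod int l)"
    by (simp only: ql power_int_1_left mult_1_left)
  also have "\<dots> = q ^ nat (n mod int l)"
    using l_ge_3 by (simp add: power_int_def)
  also have "\<dots> = 1 \<longleftrightarrow> nat (n mod int l) = 0"
  proof -
    have "nat (n mod int l) < l"
      using l_ge_3 by (simp add: nat_less_iff)
    moreover have "q ^ k = 1 \<longleftrightarrow> k = 0" if "k < l" for k
      using that root by (cases "k = 0") (simp_all add: primitive_root_of_unity_def)
    ultimately show ?thesis
      by blast
  qed
  also have "\<dots> \<longleftrightarrow> int l dvd n"
    using l_ge_3 by (simp add: dvd_eq_mod_eq_0 order_antisym_conv)
  finally show ?thesis .
qed

lemma q_minus_inverse_nonzero: "q - inverse q \<noteq> 0"
proof
  assume "q - inverse q = 0"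
  then have "q * q = 1"
    using q_nonzero by (simp add: field_simps)
  then have "q powi 2 = 1"
    by (simp add: power2_eq_square)
  then have "int l dvd 2"
    by (simp only: q_power_int_eq_1_iff)
  then show False
    using l_ge_3 by (auto dest: zdvd_imp_le)
qed

section \<open>The quantum torus\<close>

text \<open>The coordinates of an exponent \<open>(a, b, c, d)\<close> belong to \<open>K, Y, \<phi>, X\<close> in this order, and
  \<open>\<beta>\<close> records the powers of \<open>q\<close> that arise when \<open>K\<^sup>a Y\<^sup>b \<phi>\<^sup>c X\<^sup>d K\<^sup>a\<^sup>' Y\<^sup>b\<^sup>' \<phi>\<^sup>c\<^sup>' X\<^sup>d\<^sup>'\<close> is brought
  into the same form: \<open>K\<^sup>a\<^sup>'\<close> passes \<open>X\<close>, \<open>\<phi>\<close> and \<open>Y\<close>, and \<open>Y\<^sup>b\<^sup>'\<close> passes \<open>X\<close> and \<open>\<phi>\<close>. Placing \<open>\<phi>\<close>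
  before \<open>X\<close> makes \<open>\<phi>\<close> dominate \<open>X\<close> in the lexicographic order.\<close>

fun beta :: "torus_exponent \<Rightarrow> torus_exponent \<Rightarrow> int" where
  "beta (a, b, c, d) (a', b', c', d') = a' * (b - c - d) + b' * (d - c)"

definition sigma :: "torus_exponent \<Rightarrow> torus_exponent \<Rightarrow> 'k" where
  "sigma u v = q powi beta u v"

sublocale bicharacter sigma
proof
  fix u v w :: torus_exponent
  show "sigma (u + v) w = sigma u w * sigma v w"
    by (cases u; cases v; cases w)
      (simp add: sigma_def q_nonzero algebra_simps flip: power_int_add)
  show "sigma u (v + w) = sigma u v * sigma u w"
    by (cases u; cases v; cases w)
      (simp add: sigma_def q_nonzero algebra_simps flip: power_int_add)
  show "sigma u v \<noteq> 0"
    by (simp add: sigma_def q_nonzero)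
qed

notation tmult (infixl \<open>\<star>\<close> 70)

abbreviation mon :: "torus_exponent \<Rightarrow> (torus_exponent \<Rightarrow>\<^sub>0 'k)" where
  "mon v \<equiv> Poly_Mapping.single v 1"

text \<open>The image of \<open>E\<close> is \<open>Y\<inverse> \<phi> + \<gamma> Y\<inverse> X\<close>. The first summand \<open>F\<close> satisfies \<open>F Y = q\<inverse> Y F\<close> and does not
  contribute to \<open>E Y - q\<inverse> Y E\<close>; the second contributes \<open>\<gamma> (q - q\<inverse>) X = X\<close>.\<close>

definition gen_image :: "ageing_gen \<Rightarrow> (torus_exponent \<Rightarrow>\<^sub>0 'k)" where
  "gen_image g = (case g of
     gE \<Rightarrow> mon (0, -1, 1, 0) + Poly_Mapping.single (0, -1, 0, 1) (inverse (q - inverse q))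
   | gK \<Rightarrow> mon (1, 0, 0, 0)
   | gKinv \<Rightarrow> mon (-1, 0, 0, 0)
   | gX \<Rightarrow> mon (0, 0, 0, 1)
   | gY \<Rightarrow> mon (0, 1, 0, 0))"

abbreviation torus_map :: "(ageing_gen, 'k) free_alg \<Rightarrow> (torus_exponent \<Rightarrow>\<^sub>0 'k)" where
  "torus_map \<equiv> substitute gen_image"

lemma torus_map_relator:
  assumes "r \<in> relators"
  shows "torus_map r = 0"
proof -
  have one: "(1 :: torus_exponent \<Rightarrow>\<^sub>0 'k) = mon (0, 0, 0, 0)"
    by (metis single_one zero_prod_def)
  have zero: "(0 :: torus_exponent) = (0, 0, 0, 0)"
    by (simp add: zero_prod_def)
  have "q * inverse (q - inverse q) = 1 + inverse q * inverse (q - inverse q)"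
  proof -
    have "(q - inverse q) * inverse (q - inverse q) = 1"
      using q_minus_inverse_nonzero by simp
    then show ?thesis
      by (simp only: left_diff_distrib diff_eq_eq)
  qed
  \<comment> \<open>the relation between \<open>E\<close> and \<open>Y\<close> reduces to \<open>\<gamma> (q - q\<inverse>) = 1\<close>\<close>
  then have gamma: "Poly_Mapping.single v (q * inverse (q - inverse q)) =
    mon v + Poly_Mapping.single v (inverse q * inverse (q - inverse q))" for v :: torus_exponent
    by (simp only: single_add)
  show ?thesis
    using assms unfolding ageing_relators_def Let_def
    by (auto simp: substitute_diff substitute_add substitute_mult substitute_var substitute_const
        substitute_one gen_image_def single_tmult_single tmult_add_left tmult_add_right sigma_def
        one zero power_int_minus gamma mult.commute power_int_def power_inverse q_nonzero)
qed

lemma torus_map_relation_ideal: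
  assumes "f \<in> relation_ideal relators"
  shows "torus_map f = 0"
proof -
  interpret F: ring "ring_of_type_algebra :: (ageing_gen, 'k) free_alg ring"
    by (rule ring_ring_of_type_algebra)
  have "ideal {f. torus_map f = 0} ring_of_type_algebra"
  proof (rule idealI)
    show "subgroup {f. torus_map f = 0} (add_monoid ring_of_type_algebra)"
    proof (rule F.add.subgroupI)
      fix a assume a: "a \<in> {f. torus_map f = 0}"
      have "\<ominus>\<^bsub>ring_of_type_algebra\<^esub> a = - a"
        by (rule F.minus_equality) (simp_all add: ring_of_type_algebra_def)
      then show "\<ominus>\<^bsub>ring_of_type_algebra\<^esub> a \<in> {f. torus_map f = 0}"
        using a by (simp add: substitute_minus)
    next
      have "0 \<in> {f. torus_map f = 0}"
        by simp
      then show "{f. torus_map f = 0} \<noteq> {}"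
        by blast
    qed (simp_all add: ring_of_type_algebra_def substitute_add)
  qed (use F.ring_axioms in \<open>simp_all add: ring_of_type_algebra_def substitute_mult\<close>)
  then have "relation_ideal relators \<subseteq> {f. torus_map f = 0}"
    by (rule relation_ideal_minimal) (use torus_map_relator in blast)
  then show ?thesis
    using assms by blast
qed

section \<open>Embedding the ageing algebra into the torus\<close>

lemma leading_power:
  assumes f: "leading (torus_map f) u" and t: "t 0 = 0" "\<And>n. t (Suc n) = u + t n"
  shows "leading (torus_map (f ^ n)) (t n)"
proof (induction n)
  case 0
  show ?case
    using leading_single[of 1 0] t(1) by (simp add: substitute_one)
next
  case (Suc n)
  show ?case
    using leading_tmult[OF f Suc] t(2) by (simp add: substitute_mult)
qed

lemma leading_gens:
  "leading (torus_map (vK ^ n)) (int n, 0, 0, 0)"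
  "leading (torus_map (vK' ^ n)) (- int n, 0, 0, 0)"
  "leading (torus_map (vY ^ n)) (0, int n, 0, 0)"
  "leading (torus_map (vX ^ n)) (0, 0, 0, int n)"
  "leading (torus_map (vE ^ n)) (0, - int n, int n, 0)"
proof -
  have gens: "leading (torus_map vK) (1, 0, 0, 0)" "leading (torus_map vK') (-1, 0, 0, 0)"
    "leading (torus_map vY) (0, 1, 0, 0)" "leading (torus_map vX) (0, 0, 0, 1)"
    by (simp_all add: substitute_var gen_image_def leading_single)
  show "leading (torus_map (vK ^ n)) (int n, 0, 0, 0)"
    using leading_power[OF gens(1), of "\<lambda>n. (int n, 0, 0, 0)" n] by (simp add: zero_prod_def)
  show "leading (torus_map (vK' ^ n)) (- int n, 0, 0, 0)"
    using leading_power[OF gens(2), of "\<lambda>n. (- int n, 0, 0, 0)" n] by (simp add: zero_prod_def)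
  show "leading (torus_map (vY ^ n)) (0, int n, 0, 0)"
    using leading_power[OF gens(3), of "\<lambda>n. (0, int n, 0, 0)" n] by (simp add: zero_prod_def)
  show "leading (torus_map (vX ^ n)) (0, 0, 0, int n)"
    using leading_power[OF gens(4), of "\<lambda>n. (0, 0, 0, int n)" n] by (simp add: zero_prod_def)
  have "leading (torus_map vE) (0, -1, 1, 0)"
    unfolding leading_def
  proof
    show "(0, -1, 1, 0) \<in> Poly_Mapping.keys (torus_map vE)"
      by (simp add: in_keys_iff substitute_var gen_image_def lookup_add lookup_single)
    show "\<forall>v\<in>Poly_Mapping.keys (torus_map vE). v \<le> (0, -1, 1, 0)"
      by (auto simp: in_keys_iff substitute_var gen_image_def lookup_add lookup_single when_def split: if_splits)
  qed
  from leading_power[OF this, of "\<lambda>n. (0, - int n, int n, 0)" n]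
  show "leading (torus_map (vE ^ n)) (0, - int n, int n, 0)"
    by (simp add: zero_prod_def)
qed

text \<open>The leading exponent of the image of \<open>E\<close> is that of \<open>Y\<inverse> \<phi>\<close>. The exponents of \<open>E\<close> and \<open>X\<close> in
  the monomial reappear as those of \<open>\<phi>\<close> and \<open>X\<close>, so the monomial is determined by its leading exponent.\<close>

lemma leading_monomial:
  "leading (torus_map (monomial (a, b, c, d))) (a, int b - int d, int d, int c)"
proof -
  have "leading (torus_map (K_power a)) (a, 0, 0, 0)"
    using leading_gens(1)[of "nat a"] leading_gens(2)[of "nat (- a)"] by (cases "a \<ge> 0") (simp_all add: K_power_def)
  from leading_tmult[OF this leading_tmult[OF leading_gens(3)[of b]
      leading_tmult[OF leading_gens(4)[of c] leading_gens(5)[of d]]]]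
  show ?thesis
    by (simp add: monomial_def substitute_mult)
qed

lemma torus_map_sum: "torus_map (sum f A) = (\<Sum>i\<in>A. torus_map (f i))"
  by (induction A rule: infinite_finite_induct) (simp_all add: substitute_add)

lemma torus_map_combination:
  "torus_map (combination p) =
     (\<Sum>i\<in>Poly_Mapping.keys p. scalar (Poly_Mapping.lookup p i) \<star> torus_map (monomial i))"
  by (simp add: combination_def extend_def torus_map_sum scale_def substitute_mult substitute_const)

text \<open>Modulo the relators every element is a combination of ordered monomials, and the images of
  these are independent: the kernel is no larger than the ideal of relations.\<close>

theorem torus_map_eq_zero_iff: "torus_map f = 0 \<longleftrightarrow> f \<in> relation_ideal relators"
proof
  assume f: "torus_map f = 0"
  obtain p where p: "f \<doteq> combination p"
    using all_spanned[of f] by (auto simp: spanned_def)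
  have "torus_map (f - combination p) = 0"
    using p torus_map_relation_ideal by (simp add: congruent_mod_def)
  then have "(\<Sum>i\<in>Poly_Mapping.keys p. scalar (Poly_Mapping.lookup p i) \<star> torus_map (monomial i)) = 0"
    using f by (simp add: substitute_diff torus_map_combination)
  then have "p = 0"
    by (rule leading_independent[where t = "\<lambda>(a, b, c, d). (a, int b - int d, int d, int c)", rotated 2])
      (auto simp: leading_monomial inj_def)
  then show "f \<in> relation_ideal relators"
    using p by (simp add: congruent_mod_def combination_def extend_zero)
qed (rule torus_map_relation_ideal)

abbreviation A where "A \<equiv> ageing_algebra q"

abbreviation cls :: "(ageing_gen, 'k) free_alg \<Rightarrow> (ageing_gen, 'k) free_alg set" where
  "cls \<equiv> coset relators"

lemma cls_eq_iff: "cls f = cls g \<longleftrightarrow> torus_map f = torus_map g"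
  by (simp add: coset_eq_iff flip: torus_map_eq_zero_iff) (simp add: substitute_diff)

lemma A_ops:
  "cls f \<otimes>\<^bsub>A\<^esub> cls g = cls (f * g)" "cls f \<oplus>\<^bsub>A\<^esub> cls g = cls (f + g)"
  "\<one>\<^bsub>A\<^esub> = cls 1" "\<zero>\<^bsub>A\<^esub> = cls 0" "carrier A = range cls"
  by (simp_all add: ageing_algebra_def mult_coset add_coset one_presented_algebra
      zero_presented_algebra carrier_presented_algebra)

text \<open>Embedded into a torus without zero divisors, the algebra is a domain.\<close>

lemma prime_ring_A: "prime_ring A"
  unfolding prime_ring_def
proof (intro conjI ballI impI)
  show "ring A"
    by (simp add: ageing_algebra_def ring_presented_algebra)
  show "\<one>\<^bsub>A\<^esub> \<noteq> \<zero>\<^bsub>A\<^esub>"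
    by (simp add: A_ops cls_eq_iff substitute_one)
  fix x y assume "x \<in> carrier A" "y \<in> carrier A"
    and eq: "\<forall>r\<in>carrier A. x \<otimes>\<^bsub>A\<^esub> r \<otimes>\<^bsub>A\<^esub> y = \<zero>\<^bsub>A\<^esub>"
  then obtain f g where fg: "x = cls f" "y = cls g"
    by (auto simp: A_ops)
  have "cls 1 \<in> carrier A"
    by (simp add: A_ops)
  with eq have "torus_map f \<star> torus_map g = 0"
    by (fastforce simp: fg A_ops cls_eq_iff substitute_mult)
  then show "x = \<zero>\<^bsub>A\<^esub> \<or> y = \<zero>\<^bsub>A\<^esub>"
    by (simp add: tmult_eq_zero_iff fg A_ops cls_eq_iff)
qed

section \<open>The centre of the ageing algebra\<close>

definition radical :: "torus_exponent set" where
  "radical = {v. \<forall>w. sigma v w = sigma w v}"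

lemma sigma_commute_iff: "sigma v w = sigma w v \<longleftrightarrow> int l dvd beta v w - beta w v"
proof -
  have "sigma v w = sigma w v \<longleftrightarrow> q powi (beta v w - beta w v) = 1"
    using q_nonzero by (simp add: sigma_def power_int_diff field_simps)
  then show ?thesis
    by (simp only: q_power_int_eq_1_iff)
qed

lemma radical_iff:
  "(a, b, c, d) \<in> radical \<longleftrightarrow>
     int l dvd b - c - d \<and> int l dvd d - c - a \<and> int l dvd a + b \<and> int l dvd a - b"
proof
  assume "(a, b, c, d) \<in> radical"
  then have "int l dvd beta (a, b, c, d) w - beta w (a, b, c, d)" for w
    unfolding radical_def sigma_commute_iff by blast
  from this[of "(1, 0, 0, 0)"] this[of "(0, 1, 0, 0)"] this[of "(0, 0, 1, 0)"] this[of "(0, 0, 0, 1)"]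
  show "int l dvd b - c - d \<and> int l dvd d - c - a \<and> int l dvd a + b \<and> int l dvd a - b"
    by (simp add: algebra_simps)
next
  assume *: "int l dvd b - c - d \<and> int l dvd d - c - a \<and> int l dvd a + b \<and> int l dvd a - b"
  have "int l dvd beta (a, b, c, d) w - beta w (a, b, c, d)" for w
  proof -
    obtain a' b' c' d' where w: "w = (a', b', c', d')"
      by (cases w)
    have "beta (a, b, c, d) w - beta w (a, b, c, d) =
      a' * (b - c - d) + b' * (d - c - a) + c' * (a + b) + d' * (a - b)"
      by (simp add: w algebra_simps)
    then show ?thesis
      using * by (simp add: dvd_add dvd_mult)
  qed
  then show "(a, b, c, d) \<in> radical"
    unfolding radical_def sigma_commute_iff by blast
qed

lemma radical_add: "u \<in> radical \<Longrightarrow> v \<in> radical \<Longrightarrow> u + v \<in> radical"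
  by (simp add: radical_def add_left add_right)

lemma radical_diff: "u \<in> radical \<Longrightarrow> v \<in> radical \<Longrightarrow> u - v \<in> radical"
  by (simp add: radical_def diff_left diff_right)

lemma mon_in_range_add:
  assumes "mon u \<in> range torus_map" "mon v \<in> range torus_map"
  shows "mon (u + v) \<in> range torus_map"
proof -
  obtain f g where fg: "torus_map f = mon u" "torus_map g = mon v"
    using assms by (metis imageE)
  have "torus_map (const (inverse (sigma u v)) * (f * g)) = mon (u + v)"
    using nonzero[of u v] by (simp add: substitute_mult substitute_const fg single_tmult_single)
  then show ?thesis
    by (metis rangeI)
qed

text \<open>Here \<open>\<phi>\<close> is recovered as \<open>Y E - \<gamma> X\<close>.\<close>

lemma mon_basis_in_range:
  "mon (1, 0, 0, 0) \<in> range torus_map" "mon (-1, 0, 0, 0) \<in> range torus_map"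
  "mon (0, 1, 0, 0) \<in> range torus_map" "mon (0, 0, 1, 0) \<in> range torus_map"
  "mon (0, 0, 0, 1) \<in> range torus_map"
proof -
  have "torus_map vK = mon (1, 0, 0, 0)" "torus_map vK' = mon (-1, 0, 0, 0)"
    "torus_map vY = mon (0, 1, 0, 0)" "torus_map vX = mon (0, 0, 0, 1)"
    by (simp_all add: substitute_var gen_image_def)
  then show "mon (1, 0, 0, 0) \<in> range torus_map" "mon (-1, 0, 0, 0) \<in> range torus_map"
    "mon (0, 1, 0, 0) \<in> range torus_map" "mon (0, 0, 0, 1) \<in> range torus_map"
    by (metis rangeI)+
  have zero: "(0 :: torus_exponent) = (0, 0, 0, 0)"
    by (simp add: zero_prod_def)
  have "torus_map (vY * vE - const (inverse (q - inverse q)) * vX) = mon (0, 0, 1, 0)"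
    by (simp add: substitute_diff substitute_mult substitute_var substitute_const gen_image_def
        tmult_add_right single_tmult_single sigma_def zero)
  then show "mon (0, 0, 1, 0) \<in> range torus_map"
    by (metis rangeI)
qed

lemma mon_in_range: "mon (a, int b, int c, int d) \<in> range torus_map"
proof -
  have 0: "mon 0 \<in> range torus_map"
    using substitute_one[of gen_image] by (metis rangeI single_one)
  have *: "mon (t n) \<in> range torus_map" if "mon u \<in> range torus_map" "t 0 = 0" "\<And>n. t (Suc n) = u + t n"
    for t u and n :: nat
    by (induction n) (use that 0 mon_in_range_add in auto)
  have "mon (int n, 0, 0, 0) \<in> range torus_map" "mon (- int n, 0, 0, 0) \<in> range torus_map" for n
    using *[of "(1, 0, 0, 0)" "\<lambda>n. (int n, 0, 0, 0)"] *[of "(-1, 0, 0, 0)" "\<lambda>n. (- int n, 0, 0, 0)"]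
      mon_basis_in_range by (simp_all add: zero_prod_def)
  from this(1)[of "nat a"] this(2)[of "nat (- a)"] have a: "mon (a, 0, 0, 0) \<in> range torus_map"
    by (cases "a \<ge> 0") simp_all
  have bcd: "mon (0, int b, 0, 0) \<in> range torus_map" "mon (0, 0, int c, 0) \<in> range torus_map"
    "mon (0, 0, 0, int d) \<in> range torus_map"
    using *[of "(0, 1, 0, 0)" "\<lambda>n. (0, int n, 0, 0)"] *[of "(0, 0, 1, 0)" "\<lambda>n. (0, 0, int n, 0)"]
      *[of "(0, 0, 0, 1)" "\<lambda>n. (0, 0, 0, int n)"]
      mon_basis_in_range by (simp_all add: zero_prod_def)
  show ?thesis
    using mon_in_range_add[OF a mon_in_range_add[OF bcd(1) mon_in_range_add[OF bcd(2,3)]]] by simp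
qed

text \<open>The torus monomials \<open>K\<close>, \<open>Y\<close>, \<open>\<phi>\<close>, \<open>X\<close> lie in the image, so commuting with the algebra already
  forces the exponents into the radical; conversely elements supported there commute with
  the whole torus.\<close>

lemma center_A_iff: "cls f \<in> ring_center A \<longleftrightarrow> Poly_Mapping.keys (torus_map f) \<subseteq> radical"
proof -
  have "cls f \<in> ring_center A \<longleftrightarrow> (\<forall>g. cls f \<otimes>\<^bsub>A\<^esub> cls g = cls g \<otimes>\<^bsub>A\<^esub> cls f)"
    by (simp add: ring_center_def A_ops(5))
  also have "\<dots> \<longleftrightarrow> (\<forall>t\<in>range torus_map. torus_map f \<star> t = t \<star> torus_map f)"
    by (simp add: A_ops(1) cls_eq_iff substitute_mult)
  also have "\<dots> \<longleftrightarrow> Poly_Mapping.keys (torus_map f) \<subseteq> radical"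
  proof
    assume comm: "\<forall>t\<in>range torus_map. torus_map f \<star> t = t \<star> torus_map f"
    show "Poly_Mapping.keys (torus_map f) \<subseteq> radical"
    proof
      fix v assume v: "v \<in> Poly_Mapping.keys (torus_map f)"
      have *: "int l dvd beta v w - beta w v" if "mon w \<in> range torus_map" for w
        using bspec[OF comm that] v unfolding commute_monomial_iff sigma_commute_iff by blast
      obtain a b c d where abcd: "v = (a, b, c, d)"
        by (cases v)
      show "v \<in> radical"
        using *[OF mon_basis_in_range(1)] *[OF mon_basis_in_range(3)] *[OF mon_basis_in_range(4)]
          *[OF mon_basis_in_range(5)]
        by (simp add: abcd radical_iff algebra_simps)
    qed
  next
    assume "Poly_Mapping.keys (torus_map f) \<subseteq> radical"
    then have "torus_map f \<star> t = t \<star> torus_map f" for t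
      by (intro central_if_radical) (auto simp: radical_def)
    then show "\<forall>t\<in>range torus_map. torus_map f \<star> t = t \<star> torus_map f"
      by blast
  qed
  finally show ?thesis .
qed

section \<open>The lattice of central exponents\<close>

definition order_q2 :: int where
  "order_q2 = (if odd l then int l else int l div 2)"

lemma order_q2: "order_q2 > 0" "order_q2 \<le> int l" "int l dvd 2 * order_q2"
  using l_ge_3 by (auto simp: order_q2_def)

lemma dvd_double_iff: "int l dvd 2 * a \<longleftrightarrow> order_q2 dvd a"
proof (cases "odd l")
  case True
  then have "coprime (int l) 2"
    by (simp add: coprime_commute)
  then show ?thesis
    using True by (simp add: order_q2_def coprime_dvd_mult_right_iff)
next
  case False
  then obtain m where m: "l = 2 * m"
    by blast
  have "order_q2 = int m"
    unfolding order_q2_def using m by simp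
  then show ?thesis
    using m by simp
qed

text \<open>Adding the congruences gives \<open>2 a \<equiv> 0\<close> and \<open>2 c \<equiv> 0\<close> modulo \<open>l\<close>; given \<open>a\<close> and \<open>c\<close>, the remaining
  ones determine \<open>b\<close> and \<open>d\<close> modulo \<open>l\<close>.\<close>

lemma radical_iff_order_q2:
  "(a, b, c, d) \<in> radical \<longleftrightarrow>
     order_q2 dvd a \<and> order_q2 dvd c \<and> int l dvd b - a \<and> int l dvd d - c - a"
proof
  assume "(a, b, c, d) \<in> radical"
  then have h: "int l dvd b - c - d" "int l dvd d - c - a" "int l dvd a + b" "int l dvd a - b"
    by (simp_all add: radical_iff)
  have "int l dvd (a + b) + (a - b)" "int l dvd (a - b) + ((b - c - d) + (d - c - a))"
    using h by (blast intro: dvd_add)+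
  then have "int l dvd 2 * a" "int l dvd 2 * (- c)"
    by (simp_all add: algebra_simps)
  moreover have "int l dvd - (a - b)"
    using h(4) by (simp only: dvd_minus_iff)
  ultimately show "order_q2 dvd a \<and> order_q2 dvd c \<and> int l dvd b - a \<and> int l dvd d - c - a"
    using h(2) unfolding dvd_double_iff by simp
next
  assume h: "order_q2 dvd a \<and> order_q2 dvd c \<and> int l dvd b - a \<and> int l dvd d - c - a"
  then have k: "int l dvd 2 * a" "int l dvd 2 * c" "int l dvd b - a" "int l dvd d - c - a"
    by (simp_all add: dvd_double_iff)
  have "int l dvd (b - a) + 2 * a" "int l dvd - (b - a)" "int l dvd (b - a) - (d - c - a) - 2 * c"
    using k by (blast intro: dvd_add dvd_diff dvd_minus_iff[THEN iffD2])+
  then show "(a, b, c, d) \<in> radical"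
    using k(4) by (simp add: radical_iff algebra_simps)
qed

definition representatives :: "torus_exponent set" where
  "representatives = {0..<order_q2} \<times> {0..<int l} \<times> {0..<order_q2} \<times> {0..<int l}"

text \<open>Reducing \<open>a\<close> and \<open>c\<close> modulo the order of \<open>q\<^sup>2\<close> within the coset of the radical also changes \<open>b\<close> by the
  amount subtracted from \<open>a\<close>, and \<open>d\<close> by the sum of both amounts.\<close>

fun representative :: "torus_exponent \<Rightarrow> torus_exponent" where
  "representative (a, b, c, d) =
     (a mod order_q2, (b - order_q2 * (a div order_q2)) mod int l, c mod order_q2,
      (d - (order_q2 * (a div order_q2) + order_q2 * (c div order_q2))) mod int l)"

lemma representative_in: "representative v \<in> representatives"
  using order_q2 l_ge_3 by (cases v) (simp add: representatives_def)

lemma diff_representative: "v - representative v \<in> radical"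
proof -
  obtain a b c d where v: "v = (a, b, c, d)"
    by (cases v)
  let ?h = order_q2
  have "int l dvd b - (?h * (a div ?h) + (b - ?h * (a div ?h)) mod int l)"
    using dvd_minus_mod[of "int l" "b - ?h * (a div ?h)"] by (simp only: diff_diff_eq)
  moreover have "int l dvd d - (?h * (a div ?h) + (?h * (c div ?h) +
    (d - (?h * (a div ?h) + ?h * (c div ?h))) mod int l))"
    using dvd_minus_mod[of "int l" "d - (?h * (a div ?h) + ?h * (c div ?h))"]
    by (simp only: diff_diff_eq add.assoc)
  ultimately show ?thesis
    by (simp add: v radical_iff_order_q2 minus_mod_eq_mult_div algebra_simps)
qed

lemma representative_unique:
  assumes "r \<in> representatives" "s \<in> representatives" "r - s \<in> radical"
  shows "r = s"
proof -
  have small: "x = y" if "m dvd x - y" "0 \<le> x" "x < m" "0 \<le> y" "y < m" for x y m :: int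
  proof -
    have "x mod m = y mod m"
      using that(1) by (simp add: mod_eq_dvd_iff)
    then show ?thesis
      using that by simp
  qed
  obtain a b c d where r: "r = (a, b, c, d)"
    by (cases r)
  obtain a' b' c' d' where s: "s = (a', b', c', d')"
    by (cases s)
  have h: "order_q2 dvd a - a'" "order_q2 dvd c - c'" "int l dvd b - b' - (a - a')"
    "int l dvd d - d' - (c - c') - (a - a')"
    using assms(3) by (simp_all add: r s radical_iff_order_q2)
  have "a = a'" "c = c'"
    using h(1,2) assms(1,2) by (auto simp: representatives_def r s intro!: small[of order_q2])
  moreover from this have "b = b'" "d = d'"
    using h(3,4) assms(1,2) by (auto simp: representatives_def r s intro!: small[of "int l"])
  ultimately show ?thesis
    by (simp add: r s)
qed

lemma finite_representatives: "finite representatives"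
  by (simp add: representatives_def)

lemma card_representatives: "card representatives = (if odd l then l ^ 2 else l ^ 2 div 2) ^ 2"
proof (cases "odd l")
  case True
  then show ?thesis
    by (simp add: representatives_def order_q2_def power2_eq_square)
next
  case False
  then obtain m where m: "l = 2 * m"
    by blast
  have ho: "order_q2 = int m"
    unfolding order_q2_def using m by simp
  show ?thesis
    unfolding representatives_def ho using m by (simp add: power2_eq_square nat_mult_distrib)
qed

section \<open>A basis over the centre\<close>

text \<open>The summand \<open>f e\<^sub>r\<close> is supported on the coset \<open>r + \<Lambda>\<close>, and the cosets of different
  representatives are disjoint, so nothing cancels.\<close>

lemma independent_over_radical:
  assumes "distinct (map snd ps)" "set (map snd ps) \<subseteq> representatives"
    and keys: "\<And>f r. (f, r) \<in> set ps \<Longrightarrow> Poly_Mapping.keys f \<subseteq> radical"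
    and zero: "(\<Sum>(f, r)\<leftarrow>ps. f \<star> mon r) = 0"
    and fr: "(f, r) \<in> set ps"
  shows "f = 0"
proof (rule ccontr)
  assume "f \<noteq> 0"
  then obtain v where v: "v \<in> Poly_Mapping.keys f"
    by (metis ex_in_conv keys_eq_empty)
  obtain as bs where ps: "ps = as @ (f, r) # bs"
    using fr by (meson split_list)
  have other: "Poly_Mapping.lookup (g \<star> mon s) (v + r) = 0" if gs: "(g, s) \<in> set as \<union> set bs" for g s
  proof -
    have s: "s \<noteq> r" "(g, s) \<in> set ps"
      using gs assms(1) by (auto simp: ps rev_image_eqI)
    have "v + r - s \<notin> radical"
    proof
      assume "v + r - s \<in> radical"
      then have "v + r - s - v \<in> radical"
        using v keys[OF fr] by (blast intro: radical_diff)
      then have "r = s"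
        using s(2) fr assms(2) by (intro representative_unique) force+
      then show False
        using s(1) by simp
    qed
    then have "v + r - s \<notin> Poly_Mapping.keys g"
      using keys[OF s(2)] by blast
    then show ?thesis
      by (simp add: lookup_tmult_single in_keys_iff)
  qed
  have lookup_list: "Poly_Mapping.lookup (\<Sum>(g, s)\<leftarrow>xs. g \<star> mon s) (v + r) = 0"
    if "set xs \<subseteq> set as \<union> set bs" for xs
    using that by (induction xs) (auto simp: lookup_add other)
  have "0 = Poly_Mapping.lookup (f \<star> mon r) (v + r)"
    using arg_cong[OF zero, of "\<lambda>h. Poly_Mapping.lookup h (v + r)"] lookup_list[of as] lookup_list[of bs]
    by (simp add: ps lookup_add)
  then show False
    using v nonzero by (simp add: lookup_tmult_single in_keys_iff)
qed

definition central_image :: "(torus_exponent \<Rightarrow>\<^sub>0 'k) set" where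
  "central_image = {t \<in> range torus_map. Poly_Mapping.keys t \<subseteq> radical}"

lemma central_image_zero: "0 \<in> central_image"
  unfolding central_image_def using rangeI[of torus_map 0] by simp

lemma central_image_add: "s \<in> central_image \<Longrightarrow> t \<in> central_image \<Longrightarrow> s + t \<in> central_image"
  unfolding central_image_def using keys_add[of s t]
  by (auto simp flip: substitute_add)

lemma central_image_single:
  assumes "(a, b, c, d) \<in> radical" "b \<ge> 0" "c \<ge> 0" "d \<ge> 0"
  shows "Poly_Mapping.single (a, b, c, d) x \<in> central_image"
proof -
  obtain f where f: "torus_map f = mon (a, b, c, d)"
    using mon_in_range[of a "nat b" "nat c" "nat d"] assms by (auto simp: image_iff)
  have "torus_map (const x * f) = Poly_Mapping.single (a, b, c, d) x"
    by (simp add: substitute_mult substitute_const f single_tmult_single)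
  then have "Poly_Mapping.single (a, b, c, d) x \<in> range torus_map"
    by (metis rangeI)
  then show ?thesis
    using assms(1) by (simp add: central_image_def)
qed

text \<open>Exponents of central monomials that, as factors, make the exponents of \<open>Y\<close>, \<open>\<phi>\<close> and \<open>X\<close>
  nonnegative when \<open>n\<close> is large.\<close>

definition shift :: "nat \<Rightarrow> torus_exponent" where
  "shift n = (0, int n * int l, int n * int l, int n * int l)"

lemma shift_radical: "shift n \<in> radical"
  by (simp add: shift_def radical_iff)

text \<open>Write an exponent as \<open>v = r + \<lambda>\<close> with a representative \<open>r\<close> and \<open>\<lambda> \<in> \<Lambda>\<close>. The coefficient \<open>e\<^sub>\<lambda>\<close> need not
  lie in the image, but it does after a sufficiently large shift. Asking for all large
  shifts lets the bounds for two summands be combined.\<close>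

lemma central_span:
  "\<exists>m. \<forall>n\<ge>m. \<exists>k. (\<forall>r\<in>representatives. k r \<in> central_image) \<and>
     mon (shift n) \<star> t = (\<Sum>r\<in>representatives. k r \<star> mon r)"
proof (induction t rule: poly_mapping_additive_induct)
  case (single v x)
  obtain a b c d where v: "v = (a, b, c, d)"
    by (cases v)
  obtain a0 b0 c0 d0 where r: "representative v = (a0, b0, c0, d0)"
    by (cases "representative v")
  have bounds: "b0 \<le> int l" "c0 \<le> int l" "d0 \<le> int l"
    using representative_in[of v] order_q2(2) by (auto simp: r representatives_def)
  define S where "S = \<bar>b\<bar> + \<bar>c\<bar> + \<bar>d\<bar>"
  have S: "S \<ge> 0"
    by (simp add: S_def)
  show ?case
  proof (intro exI[of _ "nat S + 1"] allI impI)
    fix n assume "n \<ge> nat S + 1"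
    then have "S + 1 \<le> int n"
      using S by linarith
    then have "(S + 1) * int l \<le> int n * int l"
      by (simp add: mult_right_mono)
    moreover have "S * 1 \<le> S * int l"
      using l_ge_3 S by (intro mult_left_mono) auto
    ultimately have "S + int l \<le> int n * int l"
      by (simp add: distrib_right)
    then have large: "\<bar>b\<bar> + \<bar>c\<bar> + \<bar>d\<bar> + int l \<le> int n * int l"
      by (simp add: S_def)
    define w where "w = shift n + (v - representative v)"
    define y where "y = sigma (shift n) v * x / sigma w (representative v)"
    have w: "w = (a - a0, int n * int l + (b - b0), int n * int l + (c - c0), int n * int l + (d - d0))"
      unfolding w_def shift_def r unfolding v by simp
    have "w \<in> radical"
      unfolding w_def by (intro radical_add shift_radical diff_representative)
    then have wy: "Poly_Mapping.single w y \<in> central_image"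
      unfolding w using large bounds by (intro central_image_single) auto
    let ?k = "\<lambda>s. if s = representative v then Poly_Mapping.single w y else 0"
    have "mon (shift n) \<star> Poly_Mapping.single v x = Poly_Mapping.single w y \<star> mon (representative v)"
      using nonzero[of w "representative v"] by (simp add: single_tmult_single y_def w_def)
    also have "\<dots> = (\<Sum>s\<in>representatives. if s = representative v then Poly_Mapping.single w y \<star> mon s else 0)"
      using finite_representatives representative_in by simp
    also have "\<dots> = (\<Sum>s\<in>representatives. ?k s \<star> mon s)"
      by (intro sum.cong) auto
    finally show "\<exists>k. (\<forall>r\<in>representatives. k r \<in> central_image) \<and>
      mon (shift n) \<star> Poly_Mapping.single v x = (\<Sum>r\<in>representatives. k r \<star> mon r)"
      using wy central_image_zero by (intro exI[of _ ?k]) auto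
  qed
next
  case (add f g)
  then obtain m m' where
    m: "\<And>n. n \<ge> m \<Longrightarrow> \<exists>k. (\<forall>r\<in>representatives. k r \<in> central_image) \<and>
      mon (shift n) \<star> f = (\<Sum>r\<in>representatives. k r \<star> mon r)" and
    m': "\<And>n. n \<ge> m' \<Longrightarrow> \<exists>k. (\<forall>r\<in>representatives. k r \<in> central_image) \<and>
      mon (shift n) \<star> g = (\<Sum>r\<in>representatives. k r \<star> mon r)"
    by blast
  show ?case
  proof (intro exI[of _ "max m m'"] allI impI)
    fix n assume "n \<ge> max m m'"
    then obtain k k' where
      "\<forall>r\<in>representatives. k r \<in> central_image" "mon (shift n) \<star> f = (\<Sum>r\<in>representatives. k r \<star> mon r)"
      "\<forall>r\<in>representatives. k' r \<in> central_image" "mon (shift n) \<star> g = (\<Sum>r\<in>representatives. k' r \<star> mon r)"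
      using m[of n] m'[of n] by auto
    then show "\<exists>k. (\<forall>r\<in>representatives. k r \<in> central_image) \<and>
      mon (shift n) \<star> (f + g) = (\<Sum>r\<in>representatives. k r \<star> mon r)"
      by (intro exI[of _ "\<lambda>r. k r + k' r"])
        (simp add: central_image_add tmult_add_right tmult_add_left sum.distrib)
  qed
qed

definition lift :: "(torus_exponent \<Rightarrow>\<^sub>0 'k) \<Rightarrow> (ageing_gen, 'k) free_alg" where
  "lift t = (SOME f. torus_map f = t)"

lemma torus_map_lift: "t \<in> range torus_map \<Longrightarrow> torus_map (lift t) = t"
  unfolding lift_def by (rule someI_ex) auto

lemma mon_representative_in_range: "r \<in> representatives \<Longrightarrow> mon r \<in> range torus_map"
  using mon_in_range[of "fst r" "nat (fst (snd r))" "nat (fst (snd (snd r)))" "nat (snd (snd (snd r)))"]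
  by (auto simp: representatives_def)

lemma combine_cls:
  "ring.combine A (map cls fs) (map (\<lambda>r. cls (F r)) rs) = cls (\<Sum>(f, r)\<leftarrow>zip fs rs. f * F r)"
proof -
  interpret ring A
    using prime_ring_A by (simp add: prime_ring_def)
  show ?thesis
    by (induction fs rs rule: list_induct2') (simp_all add: A_ops)
qed

theorem PI_degree: "has_PI_degree A (if odd l then l ^ 2 else l ^ 2 div 2)"
proof -
  interpret R: ring A
    using prime_ring_A by (simp add: prime_ring_def)
  interpret central_inversion A
    by unfold_locales (rule prime_ring_A)
  obtain rs where rs: "set rs = representatives" "distinct rs"
    using finite_distinct_list[OF finite_representatives] by blast
  let ?F = "\<lambda>r. lift (mon r)"
  let ?us = "map (\<lambda>r. cls (?F r)) rs"
  have F: "torus_map (?F r) = mon r" if "r \<in> set rs" for r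
    using that rs mon_representative_in_range torus_map_lift by blast
  have image: "torus_map (\<Sum>(f, r)\<leftarrow>zip fs rs. f * ?F r) = (\<Sum>(f, r)\<leftarrow>zip (map torus_map fs) rs. f \<star> mon r)"
    if "length fs = length rs" for fs
    using that F by (induction fs rs rule: list_induct2) (simp_all add: substitute_add substitute_mult)
  have "ring.dimension (central_localization A) (length ?us) (ring_center (central_localization A))
      (carrier (central_localization A))"
  proof (rule dimension_central_localization)
    show "set ?us \<subseteq> carrier A"
      by (auto simp: A_ops)
  next
    fix ks assume ks: "set ks \<subseteq> ring_center A" "length ks = length ?us" "R.combine ks ?us = \<zero>\<^bsub>A\<^esub>"
    have "ks \<in> lists (range cls)"
      using ks(1) by (auto simp: ring_center_def A_ops)
    then obtain fs where fs: "ks = map cls fs"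
      by (auto simp: lists_image)
    have len: "length fs = length rs"
      using ks(2) by (simp add: fs)
    have zero: "(\<Sum>(f, r)\<leftarrow>zip (map torus_map fs) rs. f \<star> mon r) = 0"
      using ks(3) image[OF len] by (simp add: fs combine_cls A_ops cls_eq_iff)
    have "cls f = \<zero>\<^bsub>A\<^esub>" if f: "f \<in> set fs" for f
    proof -
      obtain r where r: "(torus_map f, r) \<in> set (zip (map torus_map fs) rs)"
        using f len by (metis image_eqI in_set_impl_in_set_zip1 length_map set_map)
      have "torus_map f = 0"
      proof (rule independent_over_radical[OF _ _ _ zero r])
        show "distinct (map snd (zip (map torus_map fs) rs))"
          "set (map snd (zip (map torus_map fs) rs)) \<subseteq> representatives"
          using len rs by simp_all
        show "Poly_Mapping.keys g \<subseteq> radical" if "(g, s) \<in> set (zip (map torus_map fs) rs)" for g s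
          using set_zip_leftD[OF that] ks(1) center_A_iff by (auto simp: fs)
      qed
      then show ?thesis
        by (simp add: A_ops(4) cls_eq_iff)
    qed
    then show "set ks \<subseteq> {\<zero>\<^bsub>A\<^esub>}"
      by (simp add: fs image_subset_iff)
  next
    fix x assume "x \<in> carrier A"
    then obtain f where x: "x = cls f"
      by (auto simp: A_ops)
    obtain n k where k: "\<And>r. r \<in> representatives \<Longrightarrow> k r \<in> central_image"
      "mon (shift n) \<star> torus_map f = (\<Sum>r\<in>representatives. k r \<star> mon r)"
      using central_span[of "torus_map f"] by blast
    have shift: "torus_map (lift (mon (shift n))) = mon (shift n)"
      using mon_in_range[of 0 "n * l" "n * l" "n * l"] by (intro torus_map_lift) (simp add: shift_def)
    define z where "z = cls (lift (mon (shift n)))"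
    define ks where "ks = map cls (map (\<lambda>r. lift (k r)) rs)"
    have lift_k: "torus_map (lift (k r)) = k r" "Poly_Mapping.keys (k r) \<subseteq> radical" if "r \<in> set rs" for r
      using k(1)[of r] that rs torus_map_lift by (auto simp: central_image_def)
    have "mon (shift n) \<noteq> 0"
      by (rule leading_nonzero[OF leading_single]) simp
    then have "z \<in> ring_center A - {\<zero>\<^bsub>A\<^esub>}"
      by (simp add: z_def center_A_iff shift shift_radical A_ops cls_eq_iff)
    moreover have "set ks \<subseteq> ring_center A"
      using lift_k by (auto simp: ks_def center_A_iff)
    moreover have "length ks = length ?us"
      by (simp add: ks_def)
    moreover have "z \<otimes>\<^bsub>A\<^esub> x = R.combine ks ?us"
    proof -
      have "(\<Sum>(f, r)\<leftarrow>zip (map torus_map (map (\<lambda>r. lift (k r)) rs)) rs. f \<star> mon r) =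
        (\<Sum>r\<leftarrow>rs. k r \<star> mon r)"
        using lift_k(1) by (simp add: zip_map1 zip_same_conv_map comp_def cong: map_cong)
      also have "\<dots> = mon (shift n) \<star> torus_map f"
        using rs by (simp add: k(2) sum_list_distinct_conv_sum_set)
      finally show ?thesis
        unfolding ks_def combine_cls z_def x A_ops cls_eq_iff
        by (subst image) (simp_all add: substitute_mult shift)
    qed
    ultimately show "\<exists>z ks. z \<in> ring_center A - {\<zero>\<^bsub>A\<^esub>} \<and> set ks \<subseteq> ring_center A \<and>
        length ks = length ?us \<and> z \<otimes>\<^bsub>A\<^esub> x = R.combine ks ?us"
      by blast
  qed
  moreover have "length ?us = (if odd l then l ^ 2 else l ^ 2 div 2) ^ 2"
    using rs card_representatives distinct_card by fastforce
  ultimately show ?thesis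
    unfolding has_PI_degree_def Let_def using prime_ring_A by simp
qed

end

theorem proposition3p1:
  fixes q :: "'k::alg_closed_field" and l :: nat
  assumes "l \<ge> 3" and "primitive_root_of_unity l q"
  shows "has_PI_degree (ageing_algebra q) (if odd l then l ^ 2 else l ^ 2 div 2)"
proof -
  have "q \<noteq> 0"
    using assms by (auto simp: primitive_root_of_unity_def power_0_left split: if_splits)
  then interpret ageing_at_root q l
    by unfold_locales (use assms in simp_all)
  show ?thesis
    by (rule PI_degree)
qed

end
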